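(* Let $G$ be an irreducibly odd framed $4$-valent graph with one unicursal component, and let $K_G$ be the free knot generated by $G$. Then any representative $G'$ of $K_G$ has a smoothing $\widetilde{G}$ having the same number of vertices as $G$. In particular, $G$ is a minimal representative of the free knot $K_G$ with respect to the number of vertices, i.e. every representative of $K_G$ has at least as many vertices as $G$.
   Context: Graphs are finite, may have loops and multiple edges, and may contain free loops (closed circle components without vertices). A $4$-valent graph is *framed* if at every vertex the four emanating half-edges are split into two pairs of (formally) opposite half-edges. Framed graphs are considered up to isomorphism preserving the framing. A *unicursal component* is an equivalence class of edges under the equivalence relation generated by: two edges are equivalent if they have half-edges that are opposite at some vertex (a free loop is a unicursal component by itself). Framed $4$-valent graphs with one unicursal component are in one-to-one correspondence with (non-oriented) chord diagrams: a framed graph $G$ corresponds to the chord diagram $C(G)$ whose circle is the closed path traversing $G$ by passing from each half-edge to its opposite at every vertex, and whose chords correspond to the vertices, each chord joining the two points of the circle mapped to the same vertex. Two chords $a,b$ are *linked* if, after removing the two ends of $a$ from the circle, the ends of $b$ lie in different components. Two distinct vertices $v_1,v_2$ of $G$ are *incident* if the corresponding chords of $C(G)$ are linked, and we put $\langle v_1,v_2\rangle=1\in\mathbb{Z}_2$ if they are incident and $0$ otherwise; a vertex is not incident to itself. A vertex is *even* if the number of vertices incident to it is even, and *odd* otherwise. A framed $4$-valent graph with one unicursal component is *irreducibly odd* if all its vertices are odd and for every two distinct vertices $a,b$ there exists a vertex $c\notin\{a,b\}$ such that $\langle a,c\rangle\neq\langle b,c\rangle$. Reidemeister moves, described on chord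 diagrams (two chord ends are *adjacent* if they are joined by an arc of the circle containing no other chord ends): (1) First move: addition/removal of a chord whose two ends are adjacent (on the graph: addition/removal of a loop at a vertex formed by two non-opposite half-edges). (2) Second move: addition/removal of two chords $a,b$ such that one end of $a$ is adjacent to one end of $b$ and the other end of $a$ is adjacent to the other end of $b$ along two disjoint arcs (on the graph: addition/removal of a bigon). (3) Third move: given three chords $a,b,c$ whose six ends are grouped by three disjoint arcs into adjacent pairs, one pair consisting of an end of $a$ and an end of $b$, one of an end of $b$ and an end of $c$, and one of an end of $a$ and an end of $c$, interchange the two ends within each of the three pairs. A *free knot* is an equivalence class of framed $4$-valent graphs with one unicursal component modulo these three moves and their inverses; a *representative* of a free knot is any graph in this class. *Smoothing.* Let $v$ be a vertex of a framed graph with half-edges $a,b,c,d$, where $a$ is opposite to $c$ and $b$ is opposite to $d$. A smoothing at $v$ is either of the two framed $4$-valent graphs obtained by removing $v$ and joining the half-edges as $a$–$b$, $c$–$d$, or as $a$–$d$, $b$–$c$; the rest of the graph and the framings at the other vertices are unchanged. A smoothing of a framed graph is a graph obtained by smoothing at some (possibly empty) set of its vertices. *)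

theory Defs
  imports Main "HOL-Library.Infinite_Typeclass"
begin

section \<open>Framed 4-valent graphs\<close>

text \<open>
  A graph is given by its vertices, its half-edges, the end vertex \<open>vert\<close> of each half-edge,
  the involution \<open>mate\<close> exchanging the two halves of each edge, the involution \<open>opp\<close> exchanging
  opposite half-edges (the framing), and the number of free loops.  Loops and multiple edges
  need no special treatment.
\<close>

record ('v, 'h) framed_graph =
  verts :: "'v set"
  halves :: "'h set"
  vert :: "'h \<Rightarrow> 'v"
  mate :: "'h \<Rightarrow> 'h"
  opp :: "'h \<Rightarrow> 'h"
  free_loops :: nat

locale framed_4_graph =
  fixes G :: "('v, 'h) framed_graph"
  assumes finite_verts: "finite (verts G)"
    and finite_halves: "finite (halves G)"
    and vert_in: "h \<in> halves G \<Longrightarrow> vert G h \<in> verts G"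
    and four_valent: "v \<in> verts G \<Longrightarrow> card {h \<in> halves G. vert G h = v} = 4"
    and mate_in: "h \<in> halves G \<Longrightarrow> mate G h \<in> halves G"
    and mate_mate: "h \<in> halves G \<Longrightarrow> mate G (mate G h) = h"
    and mate_neq: "h \<in> halves G \<Longrightarrow> mate G h \<noteq> h"
    and opp_in: "h \<in> halves G \<Longrightarrow> opp G h \<in> halves G"
    and opp_opp: "h \<in> halves G \<Longrightarrow> opp G (opp G h) = h"
    and opp_neq: "h \<in> halves G \<Longrightarrow> opp G h \<noteq> h"
    and vert_opp: "h \<in> halves G \<Longrightarrow> vert G (opp G h) = vert G h"

definition framed_iso :: "('v, 'h) framed_graph \<Rightarrow> ('w, 'k) framed_graph \<Rightarrow> bool" where
  "framed_iso G G' \<longleftrightarrow>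
     (\<exists>f g. bij_betw f (verts G) (verts G') \<and> bij_betw g (halves G) (halves G') \<and>
        (\<forall>h \<in> halves G. vert G' (g h) = f (vert G h) \<and> mate G' (g h) = g (mate G h) \<and>
           opp G' (g h) = g (opp G h)) \<and>
        free_loops G = free_loops G')"

definition edges :: "('v, 'h) framed_graph \<Rightarrow> 'h set set" where
  "edges G = {{h, mate G h} | h. h \<in> halves G}"

text \<open>This relation is symmetric because \<open>opp\<close> is an involution.\<close>

definition opposite_edges :: "('v, 'h) framed_graph \<Rightarrow> ('h set \<times> 'h set) set" where
  "opposite_edges G = {(e, e'). e \<in> edges G \<and> e' \<in> edges G \<and> (\<exists>h \<in> e. opp G h \<in> e')}"

definition num_unicursal_components :: "('v, 'h) framed_graph \<Rightarrow> nat" where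
  "num_unicursal_components G = card (edges G // (opposite_edges G)\<^sup>*) + free_loops G"

definition knot_graph :: "('v, 'h) framed_graph \<Rightarrow> bool" where
  "knot_graph G \<longleftrightarrow> framed_4_graph G \<and> num_unicursal_components G = 1"


section \<open>Chord diagrams\<close>

text \<open>
  A chord diagram with a base point and a direction of the circle is encoded by the cyclic word
  listing the chords in the order in which their ends are met; every chord occurs twice.
  The non-oriented diagram of a graph is the set of all its words, which for a graph with one
  unicursal component is closed under rotation and reversal.  The list \<open>hs\<close> is the traversing
  closed path, given by the half-edges along which it leaves the successive vertices: from
  \<open>h\<close> it runs through the edge to \<open>mate h\<close> and leaves along the half-edge opposite to it.
  For a single free loop the only word is the empty one.
\<close>

definition traversing_path :: "('v, 'h) framed_graph \<Rightarrow> 'h list \<Rightarrow> bool" where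
  "traversing_path G hs \<longleftrightarrow>
     set hs \<subseteq> halves G \<and> distinct hs \<and> length hs = 2 * card (verts G) \<and>
     (\<forall>i < length hs. hs ! (Suc i mod length hs) = opp G (mate G (hs ! i)))"

definition chord_diagram :: "('v, 'h) framed_graph \<Rightarrow> 'v list set" where
  "chord_diagram G = {map (vert G) hs | hs. traversing_path G hs}"

text \<open>
  One component of the circle without the ends \<open>i < j\<close> of \<open>a\<close> is the open interval between them.
\<close>

definition linked :: "'v list \<Rightarrow> 'v \<Rightarrow> 'v \<Rightarrow> bool" where
  "linked w a b \<longleftrightarrow>
     (\<exists>i j k l. i < j \<and> j < length w \<and> k < length w \<and> l < length w \<and>
        w ! i = a \<and> w ! j = a \<and> w ! k = b \<and> w ! l = b \<and>
        k \<in> {i<..<j} \<and> l \<notin> {i..j})"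

text \<open>Being linked does not depend on the word chosen for the diagram.\<close>

definition incident :: "('v, 'h) framed_graph \<Rightarrow> 'v \<Rightarrow> 'v \<Rightarrow> bool" where
  "incident G u v \<longleftrightarrow> u \<noteq> v \<and> (\<exists>w \<in> chord_diagram G. linked w u v)"

definition even_vertex :: "('v, 'h) framed_graph \<Rightarrow> 'v \<Rightarrow> bool" where
  "even_vertex G v \<longleftrightarrow> even (card {u \<in> verts G. incident G v u})"

definition odd_vertex :: "('v, 'h) framed_graph \<Rightarrow> 'v \<Rightarrow> bool" where
  "odd_vertex G v \<longleftrightarrow> \<not> even_vertex G v"

text \<open>The pairing with values in the integers modulo 2 is represented by the truth value of
  \<^const>\<open>incident\<close>.\<close>

definition irreducibly_odd :: "('v, 'h) framed_graph \<Rightarrow> bool" where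
  "irreducibly_odd G \<longleftrightarrow>
     (\<forall>v \<in> verts G. odd_vertex G v) \<and>
     (\<forall>a \<in> verts G. \<forall>b \<in> verts G. a \<noteq> b \<longrightarrow>
        (\<exists>c \<in> verts G - {a, b}. incident G a c \<noteq> incident G b c))"


section \<open>Free knots\<close>

text \<open>
  The base point may be assumed to lie outside the arcs involved in a move.  In the third move,
  renaming the chords brings the three pairs of ends into the order displayed.
\<close>

inductive reidemeister_word :: "'v list \<Rightarrow> 'v list \<Rightarrow> bool" where
  first: "reidemeister_word (x @ y) (x @ [a, a] @ y)"
| second: "\<lbrakk>a \<noteq> b; q \<in> {[a, b], [b, a]}\<rbrakk>
    \<Longrightarrow> reidemeister_word (x @ y @ z) (x @ [a, b] @ y @ q @ z)"
| third: "\<lbrakk>distinct [a, b, c];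
      p \<in> {[a, b], [b, a]}; q \<in> {[b, c], [c, b]}; r \<in> {[a, c], [c, a]}\<rbrakk>
    \<Longrightarrow> reidemeister_word (x @ p @ y @ q @ z @ r @ t) (x @ rev p @ y @ rev q @ z @ rev r @ t)"

definition reidemeister_move :: "('v, 'h) framed_graph \<Rightarrow> ('v, 'h) framed_graph \<Rightarrow> bool" where
  "reidemeister_move G G' \<longleftrightarrow>
     knot_graph G \<and> knot_graph G' \<and>
     (\<exists>w \<in> chord_diagram G. \<exists>w' \<in> chord_diagram G'. reidemeister_word w w')"

text \<open>
  Vertices and half-edges are taken from infinite types, so that every finite graph has an
  isomorphic copy over them and moves adding vertices are always available.
\<close>

definition same_free_knot ::
  "('v::infinite, 'h::infinite) framed_graph \<Rightarrow> ('v, 'h) framed_graph \<Rightarrow> bool" where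
  "same_free_knot =
     equivclp (\<lambda>G G'. knot_graph G \<and> knot_graph G' \<and> (framed_iso G G' \<or> reidemeister_move G G'))"

definition free_knot ::
  "('v::infinite, 'h::infinite) framed_graph \<Rightarrow> ('v, 'h) framed_graph set" where
  "free_knot G = {G'. knot_graph G' \<and> same_free_knot G G'}"


section \<open>Smoothing\<close>

text \<open>
  \<open>join a b\<close> glues the ends of two half-edges \<open>a\<close> and \<open>b\<close>: their edges are merged into one edge
  between the other two halves, or closed up to a free loop if \<open>a\<close> and \<open>b\<close> form one edge.
\<close>

definition join :: "'h \<Rightarrow> 'h \<Rightarrow> ('v, 'h) framed_graph \<Rightarrow> ('v, 'h) framed_graph" where
  "join a b G =
     (if mate G a = b
      then G\<lparr>halves := halves G - {a, b}, free_loops := Suc (free_loops G)\<rparr>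
      else G\<lparr>halves := halves G - {a, b},
             mate := (mate G)(mate G a := mate G b, mate G b := mate G a)\<rparr>)"

definition remove_vertex :: "'v \<Rightarrow> ('v, 'h) framed_graph \<Rightarrow> ('v, 'h) framed_graph" where
  "remove_vertex v G = G\<lparr>verts := verts G - {v}\<rparr>"

text \<open>Replacing \<open>b\<close> by its opposite gives the other smoothing at the same vertex.\<close>

definition smoothing_at ::
  "'v \<Rightarrow> ('v, 'h) framed_graph \<Rightarrow> ('v, 'h) framed_graph \<Rightarrow> bool" where
  "smoothing_at v G G' \<longleftrightarrow>
     v \<in> verts G \<and>
     (\<exists>a \<in> halves G. \<exists>b \<in> halves G.
        vert G a = v \<and> vert G b = v \<and> b \<noteq> a \<and> b \<noteq> opp G a \<and>
        G' = remove_vertex v (join (opp G a) (opp G b) (join a b G)))"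

text \<open>
  Smoothing removes the vertex and leaves the framing elsewhere unchanged, so smoothing at a set
  of vertices is smoothing at its elements one after the other, in any order.
\<close>

definition is_smoothing :: "('v, 'h) framed_graph \<Rightarrow> ('v, 'h) framed_graph \<Rightarrow> bool" where
  "is_smoothing = (\<lambda>G G'. \<exists>v. smoothing_at v G G')\<^sup>*\<^sup>*"

end

theory Submission
  imports Defs "HOL-Library.Z2"
begin

text \<open>
  A linear-algebra version of Manturov's parity bracket.  All that matters of a representative is
  its interlacement graph \<open>A\<close>, on which the moves act as follows: add an isolated vertex; add two
  vertices with equal neighbourhoods; toggle the three adjacencies among \<open>a, b, c\<close> when their
  rows sum to zero over the other vertices.  Let \<open>E\<close> and \<open>R\<close> be the even and odd vertices.  A state
  puts a diagonal on the block of \<open>A\<close> over the field of two elements with rows and columns in \<open>E\<close>;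
  this is a smoothing at all even vertices, it has one component iff the block is nonsingular, and
  the interlacement graph of the smoothed diagram is then the Schur complement.  The bracket counts modulo 2 the pairs of
  a state and a subset \<open>S\<close> of \<open>R\<close> on which the Schur complement is isomorphic to a fixed graph
  without twins.  Counting subsets makes the bracket invariant under adding twins, since a subset
  with both twins never contributes and those with exactly one cancel in pairs.  If the fixed graph
  is that of an irreducibly odd \<open>G\<close>, the bracket of \<open>G\<close> is 1, so every representative has a
  subset of vertices as large as the vertex set of \<open>G\<close>.  Smoothing superfluous vertices one by one
  then gives a smoothing with the required number of vertices.
\<close>

section \<open>Schur complements over the field of two elements\<close>

text \<open>These rules express addition by \<^const>\<open>of_bool\<close> and would block ring normalisation.\<close>

declare add_bit_eq_xor [simp del] mult_bit_eq_and [simp del]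

text \<open>The moves preserve the parity of every surviving vertex, and a third move involves an
  even number of odd vertices: its three rows sum to zero outside the triangle, so its three degrees
  sum to zero as well. Invariance therefore splits into two cases, three even vertices or one even
  and two odd. Neither comparison of states is a bijection of all terms; they agree only after equal
  terms have cancelled in pairs, which is why the count is taken modulo 2. Irreducible oddness
  enters at both ends: the bracket of \<open>G\<close> has a single state because no vertex is even,
  and absence of twins in the fixed graph rules out every subset containing both twins of a
  representative. The smoothing description of a state is motivation. The proof extracts from a
  nonzero bracket only a subset of vertices of the right size. Schur complements are expressed by
  solutions of linear systems, so each invariance amounts to moving kernel vectors and solutions
  from one matrix to another.\<close>

lemma bit_double [simp]: "x + x = (0::bit)"
  by (cases x) auto

lemma bit_double_left [simp]: "x + (x + y) = (y::bit)"
  by (simp flip: add.assoc)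

lemma bit_add_eq_0_iff: "x + y = 0 \<longleftrightarrow> x = (y::bit)"
  by (cases x; cases y) auto

text \<open>The row combination with coefficients \<open>X\<close>, read off in a column
  \<open>q\<close> that may lie outside \<open>E\<close>.\<close>

definition lin :: "('v \<Rightarrow> 'v \<Rightarrow> bit) \<Rightarrow> 'v set \<Rightarrow> ('v \<Rightarrow> bit) \<Rightarrow> 'v \<Rightarrow> bit" where
  "lin M E X q = (\<Sum>x\<in>E. X x * M x q)"

lemma lin_insert:
  "finite E \<Longrightarrow> e \<notin> E \<Longrightarrow> lin M (insert e E) X q = X e * M e q + lin M E X q"
  by (simp add: lin_def)

lemma lin_cong:
  "(\<And>x. x \<in> E \<Longrightarrow> X x = Y x) \<Longrightarrow> (\<And>x. x \<in> E \<Longrightarrow> M x q = M' x q') \<Longrightarrow> lin M E X q = lin M' E Y q'"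
  by (simp add: lin_def)

lemma lin_add: "lin M E (\<lambda>x. X x + Y x) q = lin M E X q + lin M E Y q"
  by (simp add: lin_def distrib_right sum.distrib)

lemma lin_upd:
  assumes "finite E" "c \<in> E"
  shows "lin M E (X(c := X c + d)) q = lin M E X q + d * M c q"
proof -
  obtain F where "E = insert c F" "c \<notin> F"
    using assms(2) by (rule mk_disjoint_insert[THEN exE]) blast
  moreover have "lin M F (X(c := X c + d)) q = lin M F X q"
    by (rule lin_cong) (use calculation in auto)
  ultimately show ?thesis
    using assms by (simp add: lin_insert algebra_simps)
qed

text \<open>Nonsingularity of the block on \<open>E\<close>, phrased as a trivial left kernel: to
  transport it, it is enough to map kernel vectors injectively.\<close>

definition regular :: "('v \<Rightarrow> 'v \<Rightarrow> bit) \<Rightarrow> 'v set \<Rightarrow> bool" where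
  "regular M E \<longleftrightarrow> (\<forall>X. (\<forall>e\<in>E. lin M E X e = 0) \<longrightarrow> (\<forall>e\<in>E. X e = 0))"

text \<open>The fixed target graph, over its own vertex type. The witness \<open>c\<close> avoids
  \<open>a\<close> and \<open>b\<close>, so vertices with equal rows elsewhere count as twins
  whether or not they are adjacent.\<close>

locale pattern =
  fixes W :: "'w set" and C :: "'w \<Rightarrow> 'w \<Rightarrow> bool"
  assumes finite_W: "finite W"
    and no_twins: "\<lbrakk>a \<in> W; b \<in> W; a \<noteq> b\<rbrakk> \<Longrightarrow> \<exists>c \<in> W - {a, b}. C a c \<noteq> C b c"
begin

text \<open>
  The column \<open>X s\<close> makes \<open>s + X s\<close> orthogonal to \<open>E\<close>, so that \<open>M s t + lin M E (X s) t\<close> is the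
  entry at \<open>(s, t)\<close> of the Schur complement; its diagonal plays no role.
\<close>

definition realizes :: "('v \<Rightarrow> 'v \<Rightarrow> bit) \<Rightarrow> 'v set \<Rightarrow> 'v set \<Rightarrow> bool" where
  "realizes M E S \<longleftrightarrow> regular M E \<and>
     (\<exists>X f. bij_betw f S W \<and> (\<forall>s\<in>S. \<forall>e\<in>E. M s e + lin M E (X s) e = 0) \<and>
        (\<forall>s\<in>S. \<forall>t\<in>S. s \<noteq> t \<longrightarrow> (M s t + lin M E (X s) t = 1) = C (f s) (f t)))"

text \<open>The common scheme of the elimination and base change arguments. \<open>ker\<close> sends
  kernel vectors of the new block to kernel vectors of the old one without killing any;
  \<open>sol\<close> turns each old column solution into a new one with the same off-diagonal Schur
  entries. The bijection with \<open>W\<close> is kept.\<close>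

lemma realizes_transfer:
  assumes "realizes M E S"
    and ker: "\<And>X. \<forall>e\<in>E'. lin M' E' X e = 0 \<Longrightarrow>
      \<exists>Y. (\<forall>e\<in>E. lin M E Y e = 0) \<and> ((\<forall>e\<in>E. Y e = 0) \<longrightarrow> (\<forall>e\<in>E'. X e = 0))"
    and sol: "\<And>s X. s \<in> S \<Longrightarrow> \<forall>e\<in>E. M s e + lin M E X e = 0 \<Longrightarrow>
      \<exists>Y. (\<forall>e\<in>E'. M' s e + lin M' E' Y e = 0) \<and>
        (\<forall>t\<in>S. t \<noteq> s \<longrightarrow> M' s t + lin M' E' Y t = M s t + lin M E X t)"
  shows "realizes M' E' S"
proof -
  from assms(1) obtain X f where reg: "regular M E" and f: "bij_betw f S W"
    and X: "\<forall>s\<in>S. \<forall>e\<in>E. M s e + lin M E (X s) e = 0"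
    and C: "\<forall>s\<in>S. \<forall>t\<in>S. s \<noteq> t \<longrightarrow> (M s t + lin M E (X s) t = 1) = C (f s) (f t)"
    unfolding realizes_def by blast
  have "regular M' E'"
    unfolding regular_def
  proof (intro allI impI)
    fix X assume "\<forall>e\<in>E'. lin M' E' X e = 0"
    from ker[OF this] reg show "\<forall>e\<in>E'. X e = 0" unfolding regular_def by blast
  qed
  moreover have "\<forall>s\<in>S. \<exists>Y. (\<forall>e\<in>E'. M' s e + lin M' E' Y e = 0) \<and>
        (\<forall>t\<in>S. t \<noteq> s \<longrightarrow> M' s t + lin M' E' Y t = M s t + lin M E (X s) t)"
    using sol X by blast
  then obtain Y where "\<forall>s\<in>S. (\<forall>e\<in>E'. M' s e + lin M' E' (Y s) e = 0) \<and>
        (\<forall>t\<in>S. t \<noteq> s \<longrightarrow> M' s t + lin M' E' (Y s) t = M s t + lin M E (X s) t)"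
    by metis
  ultimately show ?thesis
    unfolding realizes_def using f C by (intro conjI exI[of _ Y] exI[of _ f]) auto
qed

text \<open>Diagonal entries at vertices of \<open>S\<close> are exempt from the comparison, since
  only off-diagonal entries of the Schur complement are prescribed. The third move uses this for its
  odd vertices.\<close>

lemma realizes_cong_imp:
  assumes "realizes M E S"
    and "\<And>p q. p \<in> E \<union> S \<Longrightarrow> q \<in> E \<union> S \<Longrightarrow> p \<noteq> q \<or> p \<in> E \<Longrightarrow> M p q = M' p q"
    and "E \<inter> S = {}"
  shows "realizes M' E S"
proof (rule realizes_transfer[OF assms(1)])
  have *: "lin M E X e = lin M' E X e" if "e \<in> E \<union> S" for X e
    by (rule lin_cong) (use that assms in auto)
  show "\<exists>Y. (\<forall>e\<in>E. lin M E Y e = 0) \<and> ((\<forall>e\<in>E. Y e = 0) \<longrightarrow> (\<forall>e\<in>E. X e = 0))"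
    if "\<forall>e\<in>E. lin M' E X e = 0" for X
    using that * by auto
  show "\<exists>Y. (\<forall>e\<in>E. M' s e + lin M' E Y e = 0) \<and>
        (\<forall>t\<in>S. t \<noteq> s \<longrightarrow> M' s t + lin M' E Y t = M s t + lin M E X t)"
    if "s \<in> S" "\<forall>e\<in>E. M s e + lin M E X e = 0" for s X
  proof (intro exI[of _ X] conjI ballI impI)
    fix e assume "e \<in> E"
    then show "M' s e + lin M' E X e = 0" using that * assms(2)[of s e] assms(3) by auto
  next
    fix t assume "t \<in> S" "t \<noteq> s"
    then show "M' s t + lin M' E X t = M s t + lin M E X t"
      using that * assms(2)[of s t] by auto
  qed
qed

lemma realizes_cong:
  assumes "\<And>p q. p \<in> E \<union> S \<Longrightarrow> q \<in> E \<union> S \<Longrightarrow> p \<noteq> q \<or> p \<in> E \<Longrightarrow> M p q = M' p q"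
    and "E \<inter> S = {}"
  shows "realizes M E S = realizes M' E S"
  by (rule iffI; erule realizes_cong_imp) (simp_all add: assms)

lemma realizes_relabel_imp:
  assumes inj: "inj_on \<pi> (E \<union> S)" and "realizes M (\<pi> ` E) (\<pi> ` S)"
  shows "realizes (\<lambda>p q. M (\<pi> p) (\<pi> q)) E S"
proof -
  let ?M = "\<lambda>p q. M (\<pi> p) (\<pi> q)"
  have injE: "inj_on \<pi> E" and injS: "inj_on \<pi> S" using inj by (auto simp: inj_on_Un)
  from assms(2) obtain X f where reg: "regular M (\<pi> ` E)" and f: "bij_betw f (\<pi> ` S) W"
    and X: "\<forall>s\<in>\<pi> ` S. \<forall>e\<in>\<pi> ` E. M s e + lin M (\<pi> ` E) (X s) e = 0"
    and C: "\<forall>s\<in>\<pi> ` S. \<forall>t\<in>\<pi> ` S. s \<noteq> t \<longrightarrow>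
      (M s t + lin M (\<pi> ` E) (X s) t = 1) = C (f s) (f t)"
    unfolding realizes_def by blast
  have l: "lin M (\<pi> ` E) Y (\<pi> q) = lin ?M E (Y \<circ> \<pi>) q" for Y q
    by (simp add: lin_def sum.reindex[OF injE])
  have "regular ?M E"
    unfolding regular_def
  proof safe
    fix Y e assume Y: "\<forall>e\<in>E. lin ?M E Y e = 0" and e: "e \<in> E"
    let ?Y = "Y \<circ> inv_into E \<pi>"
    have "lin ?M E (?Y \<circ> \<pi>) q = lin ?M E Y q" for q
      by (rule lin_cong) (use injE in auto)
    then have "\<forall>e\<in>\<pi> ` E. lin M (\<pi> ` E) ?Y e = 0" using Y by (auto simp: l)
    then have "\<forall>e\<in>\<pi> ` E. ?Y e = 0" using reg unfolding regular_def by blast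
    then show "Y e = 0" using e injE by auto
  qed
  moreover have "bij_betw (f \<circ> \<pi>) S W"
    using f injS by (metis bij_betw_trans inj_on_imp_bij_betw)
  moreover have "\<forall>s\<in>S. \<forall>e\<in>E. ?M s e + lin ?M E (X (\<pi> s) \<circ> \<pi>) e = 0"
    using X by (auto simp flip: l)
  moreover have "\<forall>s\<in>S. \<forall>t\<in>S. s \<noteq> t \<longrightarrow>
      (?M s t + lin ?M E (X (\<pi> s) \<circ> \<pi>) t = 1) = C ((f \<circ> \<pi>) s) ((f \<circ> \<pi>) t)"
    using C injS by (auto simp flip: l simp: inj_on_def)
  ultimately show ?thesis
    unfolding realizes_def
    by (intro conjI exI[of _ "\<lambda>s. X (\<pi> s) \<circ> \<pi>"] exI[of _ "f \<circ> \<pi>"])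
qed

lemma realizes_relabel:
  assumes inj: "inj_on \<pi> (E \<union> S)" and disj: "E \<inter> S = {}"
  shows "realizes (\<lambda>p q. M (\<pi> p) (\<pi> q)) E S = realizes M (\<pi> ` E) (\<pi> ` S)"
proof
  let ?\<rho> = "inv_into (E \<union> S) \<pi>"
  have \<rho>: "?\<rho> (\<pi> x) = x" if "x \<in> E \<union> S" for x using inj that by simp
  have im: "?\<rho> ` \<pi> ` E = E" "?\<rho> ` \<pi> ` S = S"
    using \<rho> by (auto simp: image_image)
  have disj': "\<pi> ` E \<inter> \<pi> ` S = {}"
    using inj disj inj_on_image_Int[of \<pi> "E \<union> S" E S] by auto
  assume "realizes (\<lambda>p q. M (\<pi> p) (\<pi> q)) E S"
  then have "realizes (\<lambda>p q. M (\<pi> (?\<rho> p)) (\<pi> (?\<rho> q))) (\<pi> ` E) (\<pi> ` S)"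
    using realizes_relabel_imp[of ?\<rho> "\<pi> ` E" "\<pi> ` S" "\<lambda>p q. M (\<pi> p) (\<pi> q)"]
    by (auto simp: im image_Un[symmetric] intro!: inj_on_inv_into)
  then show "realizes M (\<pi> ` E) (\<pi> ` S)"
    by (rule realizes_cong_imp) (use disj' \<rho> in auto)
qed (rule realizes_relabel_imp[OF inj])

section \<open>Kernel vectors, base changes and elimination of vertices\<close>

lemma not_realizes_kernel:
  assumes "\<forall>e\<in>E. lin M E X e = 0" "e \<in> E" "X e = 1"
  shows "\<not> realizes M E S"
  using assms unfolding realizes_def regular_def by fastforce

text \<open>The Gram matrix of the bilinear form \<open>M\<close> after each basis vector
  \<open>p\<close> has been replaced by \<open>p + y p * c\<close>. For \<open>y c = 0\<close> this
  base change is an involution in characteristic 2.\<close>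

definition shear :: "'v \<Rightarrow> ('v \<Rightarrow> bit) \<Rightarrow> ('v \<Rightarrow> 'v \<Rightarrow> bit) \<Rightarrow> 'v \<Rightarrow> 'v \<Rightarrow> bit" where
  "shear c y M p q = M p q + y p * M c q + y q * M p c + y p * y q * M c c"

lemma shear_shear: "y c = 0 \<Longrightarrow> shear c y (shear c y M) = M"
  by (intro ext) (simp add: shear_def algebra_simps)

text \<open>A combination of the new basis vectors is a combination of the old ones with the
  coefficient of \<open>c\<close> raised by the sum of all \<open>X x * y x\<close>; the second
  summand comes from the change of the column \<open>q\<close>.\<close>

lemma lin_shear:
  assumes "finite E" "c \<in> E"
  shows "lin (shear c y M) E X q =
    lin M E (X(c := X c + (\<Sum>x\<in>E. X x * y x))) q +
    y q * lin M E (X(c := X c + (\<Sum>x\<in>E. X x * y x))) c"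
proof -
  let ?\<sigma> = "\<Sum>x\<in>E. X x * y x"
  have "X x * shear c y M x q = X x * M x q + X x * y x * M c q + y q * (X x * M x c) +
      y q * (X x * y x * M c c)" for x
    by (simp add: shear_def algebra_simps)
  then have "lin (shear c y M) E X q = lin M E X q + ?\<sigma> * M c q + y q * lin M E X c +
      y q * (?\<sigma> * M c c)"
    by (simp only: lin_def sum.distrib sum_distrib_left sum_distrib_right)
  then show ?thesis
    unfolding lin_upd[OF assms] by (simp add: algebra_simps)
qed

text \<open>Since \<open>c\<close> lies in \<open>E\<close>, the span of \<open>E\<close> is
  unchanged and every vector of \<open>S\<close> moves only within its class modulo that span. Its
  component orthogonal to \<open>E\<close>, hence the Schur complement, stays the same.\<close>

lemma realizes_shear_imp:
  assumes E: "finite E" "c \<in> E" and y: "y c = 0" and M: "realizes M E S"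
  shows "realizes (shear c y M) E S"
proof (rule realizes_transfer[OF M])
  let ?M = "shear c y M"
  let ?\<sigma> = "\<lambda>X. \<Sum>x\<in>E. X x * y x"
  have \<sigma>_upd: "?\<sigma> (X(c := d)) = ?\<sigma> X" for X d
    by (rule sum.cong) (auto simp: y)
  show "\<exists>Y. (\<forall>e\<in>E. lin M E Y e = 0) \<and> ((\<forall>e\<in>E. Y e = 0) \<longrightarrow> (\<forall>e\<in>E. X e = 0))"
    if X: "\<forall>e\<in>E. lin ?M E X e = 0" for X
  proof (intro exI[of _ "X(c := X c + ?\<sigma> X)"] conjI ballI impI)
    let ?Y = "X(c := X c + ?\<sigma> X)"
    have "lin M E ?Y c = 0" using bspec[OF X E(2)] unfolding lin_shear[OF E] by (simp add: y)
    then show "lin M E ?Y e = 0" if "e \<in> E" for e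
      using bspec[OF X that] unfolding lin_shear[OF E] by simp
    fix e assume Y: "\<forall>e\<in>E. ?Y e = 0" and e: "e \<in> E"
    have "?\<sigma> ?Y = 0" by (rule sum.neutral) (use Y in \<open>auto simp del: fun_upd_apply\<close>)
    then have "?\<sigma> X = 0" unfolding \<sigma>_upd .
    then have "?Y = X" by (simp only: add_0_right fun_upd_triv)
    with Y e show "X e = 0" by (simp only:)
  qed
  show "\<exists>Y. (\<forall>e\<in>E. ?M s e + lin ?M E Y e = 0) \<and>
        (\<forall>t\<in>S. t \<noteq> s \<longrightarrow> ?M s t + lin ?M E Y t = M s t + lin M E X t)"
    if "s \<in> S" and X: "\<forall>e\<in>E. M s e + lin M E X e = 0" for s X
  \<comment> \<open>The sum undoes the base change of the vectors of \<open>E\<close>; the extra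
    \<open>y s\<close> undoes the replacement of \<open>s\<close> itself by
    \<open>s + y s * c\<close>.\<close>
  proof (rule exI[of _ "X(c := X c + ?\<sigma> X + y s)"])
    let ?Y = "X(c := X c + ?\<sigma> X + y s)"
    have eq: "?Y(c := ?Y c + ?\<sigma> ?Y) = X(c := X c + y s)"
      unfolding \<sigma>_upd by (simp add: algebra_simps)
    have "?M s q + lin ?M E ?Y q = (M s q + lin M E X q) + y q * (M s c + lin M E X c)" for q
      unfolding lin_shear[OF E] eq lin_upd[OF E] by (simp add: shear_def algebra_simps)
    then show "(\<forall>e\<in>E. ?M s e + lin ?M E ?Y e = 0) \<and>
        (\<forall>t\<in>S. t \<noteq> s \<longrightarrow> ?M s t + lin ?M E ?Y t = M s t + lin M E X t)"
      using X E by simp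
  qed
qed

lemma realizes_shear:
  assumes "finite E" "c \<in> E" "y c = 0"
  shows "realizes (shear c y M) E S = realizes M E S"
proof
  assume "realizes (shear c y M) E S"
  then have "realizes (shear c y (shear c y M)) E S"
    by (rule realizes_shear_imp[where y = y, OF assms])
  then show "realizes M E S" by (simp only: shear_shear[where y = y, OF assms(3)])
qed (rule realizes_shear_imp[where y = y, OF assms])

text \<open>The block on \<open>insert e E\<close> is the direct sum of the block on
  \<open>E\<close> and the nonsingular entry 1, and \<open>e\<close> is orthogonal to everything
  else.\<close>

lemma realizes_isolated:
  assumes E: "finite E" "e \<notin> E" and "M e e = 1"
    and M: "\<And>x. x \<in> E \<union> S \<Longrightarrow> M e x = 0 \<and> M x e = 0"
  shows "realizes M (insert e E) S = realizes M E S"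
proof -
  have l0: "lin M E X e = 0" for X by (simp add: lin_def M)
  have l: "lin M (insert e E) X q = lin M E X q" if "q \<in> E \<union> S" for X q
    using that E by (simp add: lin_insert M)
  have le: "lin M (insert e E) X e = X e" for X
    using E by (simp add: lin_insert l0 assms)
  have cg: "lin M E (X(e := d)) q = lin M E X q" for X d q
    by (rule lin_cong) (use E in auto)
  show ?thesis
  proof
    assume A: "realizes M (insert e E) S"
    show "realizes M E S"
    proof (rule realizes_transfer[OF A], goal_cases)
      case (1 X)
      then show ?case
        by (intro exI[of _ "X(e := 0)"]) (use E in \<open>auto simp: l le cg\<close>)
    next
      case (2 s X)
      then show ?case by (intro exI[of _ X]) (auto simp: l le)
    qed
  next
    assume A: "realizes M E S"
    show "realizes M (insert e E) S"
    proof (rule realizes_transfer[OF A], goal_cases)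
      case (1 X)
      then show ?case
        by (intro exI[of _ X]) (auto simp: l le)
    next
      case (2 s X)
      then show ?case
        by (intro exI[of _ "X(e := 0)"]) (auto simp: l le cg M)
    qed
  qed
qed

text \<open>The 2 by 2 block at \<open>a\<close> and \<open>b\<close> has determinant
  \<open>(d + 1)^2 + d^2 = 1\<close> and is its own inverse. Its entries sum to 0, so eliminating
  two vertices with equal rows elsewhere adds nothing to the remaining entries.\<close>

lemma realizes_bigon:
  assumes E: "finite E" "a \<notin> E" "b \<notin> E" "a \<noteq> b"
    and ab: "M a b = d" "M b a = d" "M a a = d + 1" "M b b = d + 1"
    and M: "\<And>x. x \<in> E \<union> S \<Longrightarrow> M a x = M b x \<and> M x a = M x b"
  shows "realizes M (insert a (insert b E)) S = realizes M E S"
proof -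
  let ?E = "insert a (insert b E)"
  have lab: "lin M E X a = lin M E X b" for X by (rule lin_cong) (auto simp: M)
  have l: "lin M ?E X q = (X a + X b) * M a q + lin M E X q" if "q \<in> E \<union> S" for X q
    using that E by (simp add: lin_insert M algebra_simps)
  have la: "lin M ?E X a = X a * (d + 1) + X b * d + lin M E X a" for X
    using E by (simp add: lin_insert ab algebra_simps)
  have lb: "lin M ?E X b = X a * d + X b * (d + 1) + lin M E X a" for X
    using E by (simp add: lin_insert ab lab algebra_simps)
  have cg: "lin M E (X(a := u, b := v)) q = lin M E X q" for X u v q
    by (rule lin_cong) (use E in auto)
  \<comment> \<open>The sum of the two equations is \<open>X a + X b = 0\<close>; either of them
    then determines the common value.\<close>
  have eq: "X a = X b \<and> lin M E X a = X a + r" if "r + lin M ?E X a = 0" "r + lin M ?E X b = 0" for X r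
    using that unfolding la lb
    by (cases "X a"; cases "X b"; cases d; cases r; cases "lin M E X a") auto
  have l0: "lin M ?E X q = lin M E X q" if "X a = X b" "q \<in> E \<union> S" for X q
    using that by (simp add: l)
  have cl: "lin M ?E (X(a := u, b := u)) q = lin M E X q" if "q \<in> E \<union> S" for X u q
    using that E by (simp add: l cg)
  have cla: "lin M ?E (X(a := u, b := u)) a = u + lin M E X a" for X u
    unfolding la cg using E by (simp add: algebra_simps)
  have clb: "lin M ?E (X(a := u, b := u)) b = u + lin M E X a" for X u
    unfolding lb cg using E by (simp add: algebra_simps)
  show ?thesis
  proof
    assume A: "realizes M ?E S"
    show "realizes M E S"
    proof (rule realizes_transfer[OF A], goal_cases)
      case (1 X)
      \<comment> \<open>The common value at \<open>a\<close> and \<open>b\<close> is the one forced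
        by the equation in column \<open>a\<close>.\<close>
      let ?Y = "X(a := lin M E X a, b := lin M E X a)"
      have "\<forall>e\<in>?E. lin M ?E ?Y e = 0"
        using 1 by (simp add: cl cla clb)
      moreover have "(\<forall>e\<in>?E. ?Y e = 0) \<longrightarrow> (\<forall>e\<in>E. X e = 0)"
        using E by auto
      ultimately show ?case by blast
    next
      case (2 s X)
      then have "X a = X b" using eq[of "M s a" X] M[of s] by auto
      with 2 show ?case
        by (intro exI[of _ X]) (auto simp: l0)
    qed
  next
    assume A: "realizes M E S"
    show "realizes M ?E S"
    proof (rule realizes_transfer[OF A], goal_cases)
      case (1 X)
      then have X: "X a = X b" "lin M E X a = X a" using eq[of 0 X] by auto
      then have "X a = 0" if "\<forall>e\<in>E. X e = 0"
        using that by (simp add: lin_def)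
      then have "(\<forall>e\<in>E. X e = 0) \<longrightarrow> (\<forall>e\<in>?E. X e = 0)" using X(1) by simp
      moreover have "\<forall>e\<in>E. lin M E X e = 0" using 1 X(1) by (simp add: l0)
      ultimately show ?case by blast
    next
      case (2 s X)
      let ?u = "lin M E X a + M s a"
      have "\<forall>e\<in>?E. M s e + lin M ?E (X(a := ?u, b := ?u)) e = 0"
        unfolding ball_simps cla clb using 2 M[of s] by (simp add: cl algebra_simps)
      moreover have "\<forall>t\<in>S. M s t + lin M ?E (X(a := ?u, b := ?u)) t = M s t + lin M E X t"
        by (simp add: cl)
      ultimately show ?case by blast
    qed
  qed
qed

section \<open>Twin vertices modulo the span of the eliminated block\<close>

lemma lin_cross:
  assumes "finite E" and sym: "\<And>p q. M p q = M q p"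
  shows "(\<Sum>x\<in>E. X x * lin M E Y x) = (\<Sum>y\<in>E. Y y * lin M E X y)"
proof -
  have "(\<Sum>x\<in>E. \<Sum>y\<in>E. X x * (Y y * M y x)) = (\<Sum>y\<in>E. \<Sum>x\<in>E. X x * (Y y * M y x))"
    by (rule sum.swap)
  also have "\<dots> = (\<Sum>y\<in>E. \<Sum>x\<in>E. Y y * (X x * M x y))"
    by (intro sum.cong refl) (simp add: sym[of x y for x y] mult.left_commute)
  finally show ?thesis by (simp add: lin_def sum_distrib_left)
qed

text \<open>If the rows of \<open>a\<close> and \<open>b\<close> differ by a combination
  \<open>Y\<close> of rows of \<open>E\<close>, then \<open>X a + X b + Y\<close> is a kernel
  vector, hence zero on \<open>E\<close>. The two Schur rows therefore agree, and
  \<open>f a\<close>, \<open>f b\<close> would be twins in the target graph.\<close>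

lemma not_realizes_twins:
  assumes sym: "\<And>p q. M p q = M q p" and ab: "a \<in> S" "b \<in> S" "a \<noteq> b"
    and tw: "\<And>q. q \<in> E \<union> S - {a, b} \<Longrightarrow> M b q = M a q + lin M E Y q"
    and disj: "E \<inter> S = {}"
  shows "\<not> realizes M E S"
proof
  assume "realizes M E S"
  then obtain X f where reg: "regular M E" and f: "bij_betw f S W"
    and X: "\<forall>s\<in>S. \<forall>e\<in>E. M s e + lin M E (X s) e = 0"
    and C: "\<forall>s\<in>S. \<forall>t\<in>S. s \<noteq> t \<longrightarrow> (M s t + lin M E (X s) t = 1) = C (f s) (f t)"
    unfolding realizes_def by blast
  have "\<forall>e\<in>E. lin M E (\<lambda>x. X a x + X b x + Y x) e = 0"
  proof
    fix e assume e: "e \<in> E"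
    with ab disj have "M b e = M a e + lin M E Y e" by (intro tw) auto
    moreover have "M a e + lin M E (X a) e = 0" "M b e + lin M E (X b) e = 0" using X ab e by auto
    ultimately show "lin M E (\<lambda>x. X a x + X b x + Y x) e = 0"
      unfolding lin_add by (cases "M a e"; cases "lin M E Y e"; cases "lin M E (X a) e")
        (auto simp: bit_add_eq_0_iff)
  qed
  then have "\<forall>x\<in>E. X a x + X b x + Y x = 0"
    using reg unfolding regular_def by blast
  then have *: "X b x = X a x + Y x" if "x \<in> E" for x
  proof -
    have "X a x + X b x + Y x = 0" using \<open>\<forall>x\<in>E. X a x + X b x + Y x = 0\<close> that by blast
    then show ?thesis by (cases "X a x"; cases "Y x"; cases "X b x") auto
  qed
  have "C (f a) (f t) = C (f b) (f t)" if "t \<in> S - {a, b}" for t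
  proof -
    have "lin M E (X b) t = lin M E (\<lambda>x. X a x + Y x) t"
      by (rule lin_cong) (use * in auto)
    then have "M b t + lin M E (X b) t = M a t + lin M E (X a) t"
      using tw[of t] that by (simp add: lin_add algebra_simps)
    then show ?thesis using C that ab by (metis DiffE insertCI)
  qed
  moreover have "f a \<in> W" "f b \<in> W" "f a \<noteq> f b"
    using f ab by (auto simp: bij_betw_def inj_on_def)
  then obtain c where "c \<in> W - {f a, f b}" "C (f a) c \<noteq> C (f b) c"
    using no_twins by blast
  moreover have "c \<in> f ` S" using f calculation by (auto simp: bij_betw_def)
  ultimately show False by auto
qed

text \<open>Twins modulo \<open>E\<close> have the same rows in the Schur complement, so
  \<open>b\<close> can take over the role of \<open>a\<close>, with solution \<open>X a + Y\<close>.
  The columns are the less direct half and rest on the symmetry of \<open>M\<close>.\<close>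

lemma realizes_exchange_imp:
  assumes E: "finite E" and sym: "\<And>p q. M p q = M q p"
    and ab: "a \<notin> S" "b \<notin> S" "a \<noteq> b"
    and tw: "\<And>q. q \<in> E \<union> S \<Longrightarrow> M b q = M a q + lin M E Y q"
    and R: "realizes M E (insert a S)"
  shows "realizes M E (insert b S)"
proof -
  from R obtain X f where reg: "regular M E" and f: "bij_betw f (insert a S) W"
    and X: "\<forall>s\<in>insert a S. \<forall>e\<in>E. M s e + lin M E (X s) e = 0"
    and C: "\<forall>s\<in>insert a S. \<forall>t\<in>insert a S. s \<noteq> t \<longrightarrow>
      (M s t + lin M E (X s) t = 1) = C (f s) (f t)"
    unfolding realizes_def by blast
  let ?X = "X(b := \<lambda>x. X a x + Y x)" and ?f = "f(b := f a)"
  have bij: "bij_betw ?f (insert b S) W"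
  proof -
    have "?f ` insert b S = f ` insert a S" using ab by auto
    moreover have "inj_on ?f (insert b S)" using f ab by (auto simp: bij_betw_def inj_on_def)
    ultimately show ?thesis using f by (simp add: bij_betw_def)
  qed
  have bq: "M b q + lin M E (?X b) q = M a q + lin M E (X a) q" if "q \<in> E \<union> S" for q
    using tw[OF that] by (simp add: lin_add algebra_simps)
  \<comment> \<open>Expanding column \<open>b\<close> by the twin relation leaves a cross term
    between \<open>X t\<close> and \<open>Y\<close>. By symmetry and because \<open>t + X t\<close>
    is orthogonal to \<open>E\<close>, it equals \<open>lin M E Y t\<close>, exactly the difference
    of \<open>M t b\<close> and \<open>M t a\<close>.\<close>
  have tb: "M t b + lin M E (X t) b = M t a + lin M E (X t) a" if "t \<in> S" for t
  proof -
    have "lin M E (X t) b = (\<Sum>x\<in>E. X t x * (M a x + lin M E Y x))"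
      unfolding lin_def[of M E "X t"] by (rule sum.cong) (use tw sym in auto)
    also have "\<dots> = lin M E (X t) a + (\<Sum>x\<in>E. X t x * lin M E Y x)"
      by (simp add: distrib_left sum.distrib lin_def[of M E "X t"] sym[of _ a])
    also have "(\<Sum>x\<in>E. X t x * lin M E Y x) = (\<Sum>y\<in>E. Y y * lin M E (X t) y)"
      by (rule lin_cross[OF E sym])
    also have "\<dots> = (\<Sum>y\<in>E. Y y * M y t)"
    proof (rule sum.cong[OF refl])
      fix y assume "y \<in> E"
      then have "M t y + lin M E (X t) y = 0" using X that by auto
      then show "Y y * lin M E (X t) y = Y y * M y t"
        using sym[of t y] by (cases "M t y"; cases "lin M E (X t) y") auto
    qed
    also have "\<dots> = lin M E Y t" by (simp add: lin_def)
    finally show ?thesis using tw[of t] that sym[of t] by (simp add: algebra_simps)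
  qed
  show ?thesis
    unfolding realizes_def
  proof (intro conjI exI[of _ ?X] exI[of _ ?f] reg bij ballI impI)
    show "M s e + lin M E (?X s) e = 0" if "s \<in> insert b S" "e \<in> E" for s e
      using that X bq[of e] by (cases "s = b") auto
    show "(M s t + lin M E (?X s) t = 1) = C (?f s) (?f t)"
      if "s \<in> insert b S" "t \<in> insert b S" "s \<noteq> t" for s t
    proof (cases "s = b")
      case True
      then show ?thesis using that C ab bq[of t] by auto
    next
      case False
      then have "s \<in> S" using that by auto
      then show ?thesis using that C ab tb[of s] False by (cases "t = b") auto
    qed
  qed
qed

lemma realizes_exchange:
  assumes E: "finite E" and sym: "\<And>p q. M p q = M q p"
    and ab: "a \<notin> S" "b \<notin> S" "a \<noteq> b"
    and tw: "\<And>q. q \<in> E \<union> S \<Longrightarrow> M b q = M a q + lin M E Y q"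
  shows "realizes M E (insert a S) = realizes M E (insert b S)"
proof -
  have "M a q = M b q + lin M E Y q" if "q \<in> E \<union> S" for q
    using tw[OF that] by (simp add: algebra_simps)
  then show ?thesis
    using realizes_exchange_imp[of E M a S b Y] realizes_exchange_imp[of E M b S a Y] assms
    by (metis (no_types, lifting))
qed

end

section \<open>State sums\<close>

declare sum_of_bool_eq [simp del]

lemma sum_Pow_insert:
  fixes g :: "'a set \<Rightarrow> 'b::comm_monoid_add"
  assumes "finite E" "a \<notin> E"
  shows "(\<Sum>D\<in>Pow (insert a E). g D) = (\<Sum>D\<in>Pow E. g D) + (\<Sum>D\<in>Pow E. g (insert a D))"
proof -
  have "(\<Sum>D\<in>Pow (insert a E). g D) = (\<Sum>D\<in>Pow E. g D) + (\<Sum>D\<in>insert a ` Pow E. g D)"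
    unfolding Pow_insert by (rule sum.union_disjoint) (use assms in auto)
  also have "(\<Sum>D\<in>insert a ` Pow E. g D) = (\<Sum>D\<in>Pow E. g (insert a D))"
    by (rule sum.reindex_cong[where l = "insert a"]) (use assms in \<open>auto simp: inj_on_def\<close>)
  finally show ?thesis .
qed

lemma sum_Pow_image:
  fixes g :: "'a set \<Rightarrow> 'b::comm_monoid_add"
  assumes "inj_on \<pi> E"
  shows "(\<Sum>D\<in>Pow (\<pi> ` E). g D) = (\<Sum>D\<in>Pow E. g (\<pi> ` D))"
  by (rule sum.reindex_cong[where l = "image \<pi>"])
    (use assms in \<open>auto simp: inj_on_image_Pow image_Pow_surj\<close>)

definition state_matrix :: "('v \<Rightarrow> 'v \<Rightarrow> bool) \<Rightarrow> 'v set \<Rightarrow> 'v \<Rightarrow> 'v \<Rightarrow> bit" where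
  "state_matrix A D p q = (if p = q then of_bool (p \<in> D) else of_bool (A p q))"

context pattern
begin

text \<open>A nonzero \<open>Y\<close> covers vertices that become twins only after elimination of
  \<open>E\<close>; with \<open>E\<close> containing one vertex of a triangle, this is the relation
  between the other two.\<close>

lemma sum_twins:
  assumes E: "finite E" and sym: "\<And>p q. M p q = M q p"
    and O: "finite R" "a \<notin> R" "b \<notin> R" "a \<noteq> b" "E \<inter> insert a (insert b R) = {}"
    and tw: "\<And>q. q \<in> E \<union> R \<Longrightarrow> M b q = M a q + lin M E Y q"
  shows "(\<Sum>S\<in>Pow (insert a (insert b R)). of_bool (realizes M E S)) =
    (\<Sum>S\<in>Pow R. of_bool (realizes M E S) :: bit)"
proof -
  have "(of_bool (realizes M E (insert a S)) :: bit) = of_bool (realizes M E (insert b S))"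
    and "(of_bool (realizes M E (insert a (insert b S))) :: bit) = 0" if "S \<in> Pow R" for S
  proof -
    show "(of_bool (realizes M E (insert a S)) :: bit) = of_bool (realizes M E (insert b S))"
      using realizes_exchange[of E M a S b Y] that assms by auto
    have "\<not> realizes M E (insert a (insert b S))"
      by (rule not_realizes_twins[where a = a and b = b and Y = Y]) (use that assms in auto)
    then show "(of_bool (realizes M E (insert a (insert b S))) :: bit) = 0" by simp
  qed
  then show ?thesis
    using O by (simp add: sum_Pow_insert algebra_simps cong: sum.cong_simp)
qed

text \<open>The sets \<open>E\<close> and \<open>R\<close> are arbitrary here and become the even
  and odd vertices only in \<open>bracket\<close>, so that state sums can be compared without
  computing degrees.\<close>

definition state_sum :: "('v \<Rightarrow> 'v \<Rightarrow> bool) \<Rightarrow> 'v set \<Rightarrow> 'v set \<Rightarrow> bit" where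
  "state_sum A E R = (\<Sum>D\<in>Pow E. \<Sum>S\<in>Pow R. of_bool (realizes (state_matrix A D) E S))"

lemma state_sum_cong:
  assumes "E \<inter> R = {}" "\<And>p q. p \<in> E \<union> R \<Longrightarrow> q \<in> E \<union> R \<Longrightarrow> p \<noteq> q \<Longrightarrow> A p q = A' p q"
  shows "state_sum A E R = state_sum A' E R"
proof -
  have "realizes (state_matrix A D) E S = realizes (state_matrix A' D) E S"
    if "D \<in> Pow E" "S \<in> Pow R" for D S
  proof (rule realizes_cong)
    fix p q assume "p \<in> E \<union> S" "q \<in> E \<union> S"
    then have "p \<in> E \<union> R" "q \<in> E \<union> R" using that by auto
    then show "state_matrix A D p q = state_matrix A' D p q"
      using assms(2)[of p q] by (simp add: state_matrix_def)
  qed (use that assms(1) in auto)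
  then show ?thesis by (simp add: state_sum_def cong: sum.cong_simp)
qed

lemma state_sum_relabel:
  assumes inj: "inj_on \<pi> (E \<union> R)" and "E \<inter> R = {}"
  shows "state_sum A (\<pi> ` E) (\<pi> ` R) = state_sum (\<lambda>p q. A (\<pi> p) (\<pi> q)) E R"
proof -
  have injE: "inj_on \<pi> E" and injR: "inj_on \<pi> R" using inj by (auto simp: inj_on_Un)
  have "realizes (state_matrix A (\<pi> ` D)) (\<pi> ` E) (\<pi> ` S) =
      realizes (state_matrix (\<lambda>p q. A (\<pi> p) (\<pi> q)) D) E S"
    if "D \<in> Pow E" "S \<in> Pow R" for D S
  proof -
    have injS: "inj_on \<pi> (E \<union> S)" using inj by (rule inj_on_subset) (use that in auto)
    have "realizes (state_matrix A (\<pi> ` D)) (\<pi> ` E) (\<pi> ` S) =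
        realizes (\<lambda>p q. state_matrix A (\<pi> ` D) (\<pi> p) (\<pi> q)) E S"
      using realizes_relabel[OF injS, of "state_matrix A (\<pi> ` D)"] that assms by auto
    also have "\<dots> = realizes (state_matrix (\<lambda>p q. A (\<pi> p) (\<pi> q)) D) E S"
    proof (rule realizes_cong)
      fix p q assume pq: "p \<in> E \<union> S" "q \<in> E \<union> S"
      then have "\<pi> p = \<pi> q \<longleftrightarrow> p = q" using injS by (auto simp: inj_on_def)
      moreover have "\<pi> p \<in> \<pi> ` D \<longleftrightarrow> p \<in> D" "\<pi> q \<in> \<pi> ` D \<longleftrightarrow> q \<in> D"
        using inj_on_image_mem_iff[OF injS, of _ D] pq that by auto
      ultimately show "state_matrix A (\<pi> ` D) (\<pi> p) (\<pi> q) =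
          state_matrix (\<lambda>p q. A (\<pi> p) (\<pi> q)) D p q"
        by (simp add: state_matrix_def)
    qed (use that assms in auto)
    finally show ?thesis .
  qed
  then show ?thesis
    by (simp add: state_sum_def sum_Pow_image[OF injE] sum_Pow_image[OF injR] cong: sum.cong_simp)
qed

text \<open>Of the two diagonal entries at \<open>e\<close>, 0 makes its row vanish, so the block is
  singular and contributes nothing; 1 leaves the realizations unchanged.\<close>

lemma state_sum_isolated:
  assumes fin: "finite E" "E \<inter> R = {}" and e: "e \<notin> E" "e \<notin> R"
    and A: "\<And>x. x \<in> E \<union> R \<Longrightarrow> \<not> A e x \<and> \<not> A x e"
  shows "state_sum A (insert e E) R = state_sum A E R"
proof -
  have 0: "(of_bool (realizes (state_matrix A D) (insert e E) S) :: bit) = 0"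
    and 1: "(of_bool (realizes (state_matrix A (insert e D)) (insert e E) S) :: bit) =
      of_bool (realizes (state_matrix A D) E S)"
    if "D \<in> Pow E" "S \<in> Pow R" for D S
  proof -
    have z: "state_matrix A D e x = 0" "state_matrix A D x e = 0" if "x \<in> E \<union> S" for x D
      using that \<open>S \<in> Pow R\<close> e A[of x] by (auto simp: state_matrix_def)
    have "lin (state_matrix A D) (insert e E) (\<lambda>x. of_bool (x = e)) q = state_matrix A D e q" for q
      using fin e by (simp add: lin_insert lin_def sum.neutral)
    moreover have "state_matrix A D e q = 0" if "q \<in> insert e E" for q
      using that z(1)[of q D] \<open>D \<in> Pow E\<close> e by (auto simp: state_matrix_def)
    ultimately have "\<not> realizes (state_matrix A D) (insert e E) S"
      by (intro not_realizes_kernel[where X = "\<lambda>x. of_bool (x = e)" and e = e]) auto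
    then show "(of_bool (realizes (state_matrix A D) (insert e E) S) :: bit) = 0" by simp
    have "realizes (state_matrix A (insert e D)) (insert e E) S =
        realizes (state_matrix A (insert e D)) E S"
      by (rule realizes_isolated) (use z fin e in \<open>auto simp: state_matrix_def\<close>)
    also have "\<dots> = realizes (state_matrix A D) E S"
      by (rule realizes_cong) (use e that fin in \<open>auto simp: state_matrix_def\<close>)
    finally show "(of_bool (realizes (state_matrix A (insert e D)) (insert e E) S) :: bit) =
      of_bool (realizes (state_matrix A D) E S)" by simp
  qed
  show ?thesis
    unfolding state_sum_def sum_Pow_insert[OF fin(1) e(1)]
    by (simp add: 0 1 cong: sum.cong_simp)
qed

lemma state_sum_odd_twins:
  assumes "finite E" "finite R" "E \<inter> insert a (insert b R) = {}" "a \<notin> R" "b \<notin> R" "a \<noteq> b"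
    and sym: "\<And>p q. A p q = A q p"
    and A: "\<And>x. x \<in> E \<union> R \<Longrightarrow> A b x = A a x"
  shows "state_sum A E (insert a (insert b R)) = state_sum A E R"
  unfolding state_sum_def
proof (rule sum.cong[OF refl], rule sum_twins[where Y = "\<lambda>_. 0"])
  fix D q assume "q \<in> E \<union> R"
  then show "state_matrix A D b q = state_matrix A D a q + lin (state_matrix A D) E (\<lambda>_. 0) q"
    using A[of q] assms(3-6) by (auto simp: state_matrix_def lin_def)
qed (use assms sym in \<open>auto simp: state_matrix_def\<close>)

text \<open>Four diagonals at \<open>a\<close> and \<open>b\<close> have to be summed. The two mixed
  ones cancel, being exchanged by the transposition of \<open>a\<close> and \<open>b\<close>. Of the
  equal ones, that with value \<open>A a b\<close> makes the two rows equal and the block singular;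
  the other is the situation of \<open>realizes_bigon\<close>.\<close>

lemma state_sum_even_twins:
  assumes fin: "finite E" "E \<inter> R = {}" and ab: "a \<notin> E \<union> R" "b \<notin> E \<union> R" "a \<noteq> b"
    and sym: "\<And>p q. A p q = A q p"
    and A: "\<And>x. x \<in> E \<union> R \<Longrightarrow> A b x = A a x"
  shows "state_sum A (insert a (insert b E)) R = state_sum A E R"
proof -
  let ?E = "insert a (insert b E)"
  let ?r = "\<lambda>D S. of_bool (realizes (state_matrix A D) ?E S) :: bit"
  have main: "?r D S + ?r (insert b D) S + (?r (insert a D) S + ?r (insert a (insert b D)) S) =
      of_bool (realizes (state_matrix A D) E S)"
    if D: "D \<in> Pow E" and S: "S \<in> Pow R" for D S
  proof -
    have nD: "a \<notin> D" "b \<notin> D" "a \<notin> S" "b \<notin> S" using D S ab by auto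
    define \<pi> where "\<pi> = id(a := b, b := a)"
    have im: "\<pi> ` ?E = ?E" "\<pi> ` S = S"
      using ab nD by (auto simp: \<pi>_def image_iff)
    have inj: "inj_on \<pi> (?E \<union> S)" using ab nD by (auto simp: inj_on_def \<pi>_def)
    have "?E \<inter> S = {}" using S ab fin by auto
    from realizes_relabel[OF inj this, of "state_matrix A (insert b D)"]
    have "realizes (state_matrix A (insert b D)) ?E S =
        realizes (\<lambda>p q. state_matrix A (insert b D) (\<pi> p) (\<pi> q)) ?E S"
      by (simp only: im)
    also have "\<dots> = realizes (state_matrix A (insert a D)) ?E S"
    proof (rule realizes_cong)
      fix p q assume pq: "p \<in> ?E \<union> S" "q \<in> ?E \<union> S"
      have *: "A b x = A a x" "A x b = A x a" if "x \<noteq> a" "x \<noteq> b" "x \<in> ?E \<union> S" for x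
        using A[of x] sym[of x] that S by auto
      have "\<pi> x = x" if "x \<noteq> a" "x \<noteq> b" for x using that by (simp add: \<pi>_def)
      moreover have "\<pi> a = b" "\<pi> b = a" using ab by (auto simp: \<pi>_def)
      ultimately show "state_matrix A (insert b D) (\<pi> p) (\<pi> q) = state_matrix A (insert a D) p q"
        using pq ab nD sym[of a b] *[of p] *[of q]
        by (cases "p = a"; cases "p = b"; cases "q = a"; cases "q = b")
          (simp_all add: state_matrix_def)
    qed (use S ab fin in auto)
    finally have mixed: "?r (insert b D) S = ?r (insert a D) S" by simp
    have kernel: "?r D' S = 0"
      if D': "a \<in> D' \<longleftrightarrow> A a b" "b \<in> D' \<longleftrightarrow> A a b" for D'
    proof -
      let ?M = "state_matrix A D'"
      have "lin ?M ?E (\<lambda>x. of_bool (x = a \<or> x = b)) q = ?M a q + ?M b q" for q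
      proof -
        have "lin ?M E (\<lambda>x. of_bool (x = a \<or> x = b)) q = 0"
          unfolding lin_def by (rule sum.neutral) (use ab in auto)
        then show ?thesis using ab fin by (simp add: lin_insert)
      qed
      moreover have "?M a q + ?M b q = 0" if "q \<in> ?E" for q
        using that A[of q] D' ab sym[of a b] by (auto simp: state_matrix_def)
      ultimately have "\<not> realizes ?M ?E S"
        by (intro not_realizes_kernel[where X = "\<lambda>x. of_bool (x = a \<or> x = b)" and e = a]) auto
      then show ?thesis by simp
    qed
    have bigon: "?r D' S = of_bool (realizes (state_matrix A D) E S)"
      if D': "a \<in> D' \<longleftrightarrow> \<not> A a b" "b \<in> D' \<longleftrightarrow> \<not> A a b" "D' \<inter> E = D" for D'
    proof -
      have "realizes (state_matrix A D') ?E S = realizes (state_matrix A D') E S"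
      proof (rule realizes_bigon[where d = "of_bool (A a b)"])
        fix x assume "x \<in> E \<union> S"
        then show "state_matrix A D' a x = state_matrix A D' b x \<and>
            state_matrix A D' x a = state_matrix A D' x b"
          using A[of x] sym[of x] ab S by (auto simp: state_matrix_def)
      qed (use fin ab D' sym[of a b] in \<open>auto simp: state_matrix_def\<close>)
      also have "\<dots> = realizes (state_matrix A D) E S"
        by (rule realizes_cong) (use D' S fin in \<open>auto simp: state_matrix_def\<close>)
      finally show ?thesis by simp
    qed
    have DE: "D \<inter> E = D" "insert a (insert b D) \<inter> E = D" using D ab by auto
    show ?thesis
    proof (cases "A a b")
      case True
      then show ?thesis
        using mixed kernel[of "insert a (insert b D)"] bigon[of D] nD DE by simp
    next
      case False
      then show ?thesis
        using mixed bigon[of "insert a (insert b D)"] kernel[of D] nD DE by simp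
    qed
  qed
  have "state_sum A ?E R = (\<Sum>D\<in>Pow E. \<Sum>S\<in>Pow R.
      ?r D S + ?r (insert b D) S + (?r (insert a D) S + ?r (insert a (insert b D)) S))"
    unfolding state_sum_def using ab fin by (simp add: sum_Pow_insert sum.distrib)
  also have "\<dots> = state_sum A E R"
    unfolding state_sum_def by (intro sum.cong refl main)
  finally show ?thesis .
qed

text \<open>The two sides differ by the base change exchanging \<open>b\<close> and \<open>c\<close> and then adding \<open>a\<close> to both.\<close>

lemma realizes_triangle:
  assumes E: "finite E" "a \<in> E" "E \<inter> S = {}" and d: "a \<noteq> b" "a \<noteq> c" "b \<noteq> c"
    and bc: "{b, c} \<subseteq> E \<or> {b, c} \<inter> E = {}"
    and sym: "\<And>p q. M p q = M q p" "\<And>p q. M' p q = M' q p"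
    and out: "\<And>x. x \<in> E \<union> S - {a, b, c} \<Longrightarrow> M c x = M a x + M b x"
    and diag: "M a a = M a b + M a c + 1"
    and M': "\<And>x y. x \<in> E \<union> S \<Longrightarrow> y \<in> E \<union> S - {a, b, c} \<Longrightarrow> M' x y = M x y"
      "M' a b = M a b + 1" "M' a c = M a c + 1" "M' b c = M b c + 1" "M' a a = M a a"
      "b \<in> E \<Longrightarrow> M' b b = M c c + M a a" "b \<in> E \<Longrightarrow> M' c c = M b b + M a a"
  shows "realizes M' E S = realizes M E (id(b := c, c := b) ` S)"
proof -
  define \<pi> where "\<pi> = id(b := c, c := b)"
  define y :: "'a \<Rightarrow> bit" where "y = (\<lambda>x. of_bool (x = b \<or> x = c))"
  have \<pi>: "\<pi> x = x" if "x \<noteq> b" "x \<noteq> c" for x using that by (simp add: \<pi>_def)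
  have \<pi>bc: "\<pi> b = c" "\<pi> c = b" using d by (auto simp: \<pi>_def)
  have y: "y x = 0" if "x \<noteq> b" "x \<noteq> c" for x using that by (simp add: y_def)
  have ybc: "y b = 1" "y c = 1" by (auto simp: y_def)
  have im: "\<pi> ` E = E" using bc by (auto simp: \<pi>_def image_iff)
  have inj: "inj_on \<pi> T" for T by (auto simp: inj_on_def \<pi>_def)
  let ?N = "\<lambda>p q. M (\<pi> p) (\<pi> q)"
  have sab: "M b a = M a b" "M c a = M a c" "M c b = M b c"
    "M' b a = M' a b" "M' c a = M' a c" "M' c b = M' b c"
    using sym by auto
  \<comment> \<open>Outside the triangle, row \<open>b\<close> becomes row \<open>c\<close> plus row
    \<open>a\<close>, which is row \<open>b\<close> again, and similarly for \<open>c\<close>.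
    Inside it, \<open>diag\<close> is precisely the condition under which the same base change
    toggles all three adjacencies.\<close>
  have "realizes M' E S = realizes (shear a y ?N) E S"
  proof (rule realizes_cong)
    fix p q assume p: "p \<in> E \<union> S" and q: "q \<in> E \<union> S" and pq: "p \<noteq> q \<or> p \<in> E"
    consider "q \<notin> {a, b, c}" | "p \<notin> {a, b, c}" "q \<in> {a, b, c}" |
      "p \<in> {a, b, c}" "q \<in> {a, b, c}" by blast
    then show "M' p q = shear a y ?N p q"
    proof cases
      case 1
      then have q1: "M' p q = M p q" using M'(1)[OF p] q by auto
      have q2: "M c q = M a q + M b q" using out q 1 by auto
      have q3: "\<pi> q = q" "y q = 0" "\<pi> a = a" using 1 \<pi> y d by auto
      show ?thesis
        using q1 q2 \<pi>bc \<pi>[of p] y[of p] ybc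
        by (cases "p = b"; cases "p = c") (simp_all add: shear_def q3 algebra_simps)
    next
      case 2
      then have q1: "M' q p = M q p" using M'(1)[OF q] p by auto
      have q2: "M p c = M p a + M p b" using out[of p] p 2 by (auto simp: sym(1)[of p])
      have q3: "\<pi> p = p" "y p = 0" "\<pi> a = a" using 2 \<pi> y d by auto
      show ?thesis
        using q1 q2 \<pi>bc \<pi>[of q] y[of q] ybc
        unfolding sym(2)[of p q] sym(1)[of q p]
        by (cases "q = b"; cases "q = c") (simp_all add: shear_def q3 algebra_simps)
    next
      case 3
      have q3: "\<pi> a = a" "y a = 0" using \<pi> y d by auto
      have "shear a y ?N a a = M' a a" "shear a y ?N a b = M' a b" "shear a y ?N a c = M' a c"
        "shear a y ?N b a = M' b a" "shear a y ?N c a = M' c a"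
        "shear a y ?N b c = M' b c" "shear a y ?N c b = M' c b"
        by (simp_all add: shear_def \<pi>bc ybc q3 sab M'(2-5) diag algebra_simps)
      moreover have "shear a y ?N b b = M' b b" "shear a y ?N c c = M' c c" if "b \<in> E"
        by (simp_all add: shear_def \<pi>bc ybc q3 sab M'(6-7)[OF that] algebra_simps)
      moreover have "c \<in> E \<Longrightarrow> b \<in> E" using bc by auto
      ultimately show ?thesis using 3 pq d by (elim insertE emptyE; hypsubst) (metis)+
    qed
  qed (use E in auto)
  also have "\<dots> = realizes ?N E S"
    by (rule realizes_shear) (use E y d in auto)
  also have "\<dots> = realizes M E (\<pi> ` S)"
    using realizes_relabel[OF inj, of E S M] E im by simp
  finally show ?thesis unfolding \<pi>_def .
qed

end

section \<open>The third move on state sums\<close>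

definition cube_sum :: "(bool \<Rightarrow> bool \<Rightarrow> bool \<Rightarrow> 'a::comm_monoid_add) \<Rightarrow> 'a" where
  "cube_sum h = h False False False + h True False False + h False True False + h False False True +
    h True True False + h True False True + h False True True + h True True True"

text \<open>Translating the cube by \<open>(k, l, m)\<close> permutes its eight corners; this allows
  passing from diagonal entries to row sums as coordinates.\<close>

lemma cube_sum_shift: "cube_sum (\<lambda>s t u. h (s \<noteq> k) (t \<noteq> l) (u \<noteq> m)) = cube_sum h"
  by (cases k; cases l; cases m) (simp_all add: cube_sum_def ac_simps)

lemma sum_Pow_insert3:
  fixes g :: "'a set \<Rightarrow> 'b::comm_monoid_add"
  assumes "finite E" "a \<notin> E" "b \<notin> E" "c \<notin> E" "a \<noteq> b" "a \<noteq> c" "b \<noteq> c"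
  shows "(\<Sum>D\<in>Pow (insert a (insert b (insert c E))). g D) =
    (\<Sum>D\<in>Pow E. cube_sum (\<lambda>s t u. g (D \<union> {x. x = a \<and> s \<or> x = b \<and> t \<or> x = c \<and> u})))"
proof -
  define U where "U D s t u = D \<union> {x. x = a \<and> s \<or> x = b \<and> t \<or> x = c \<and> u}" for D s t u
  have U: "U D False False False = D" "U D True False False = insert a D"
    "U D False True False = insert b D" "U D False False True = insert c D"
    "U D True True False = insert a (insert b D)" "U D True False True = insert a (insert c D)"
    "U D False True True = insert b (insert c D)"
    "U D True True True = insert a (insert b (insert c D))" for D
    by (auto simp: U_def)
  have fin: "finite (insert c E)" "finite (insert b (insert c E))" using assms by auto
  have new: "b \<notin> insert c E" "a \<notin> insert b (insert c E)" using assms by auto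
  show ?thesis
    unfolding U_def[symmetric] cube_sum_def U sum.distrib
      sum_Pow_insert[OF fin(2) new(2)] sum_Pow_insert[OF fin(1) new(1)]
      sum_Pow_insert[OF assms(1,4)]
    by (simp only: ac_simps)
qed

text \<open>The effect of a third move on adjacency. The row condition is symmetric in the three
  vertices although it singles out \<open>c\<close>; the reorderings are needed to let each vertex
  in turn serve as the pivot of the base change.\<close>

locale triangle_move =
  fixes A A' :: "'v \<Rightarrow> 'v \<Rightarrow> bool" and V :: "'v set" and a b c :: 'v
  assumes triangle: "a \<noteq> b" "a \<noteq> c" "b \<noteq> c" "a \<in> V" "b \<in> V" "c \<in> V"
    "A p q = A q p" "A' p q = A' q p"
    "x \<in> V \<Longrightarrow> x \<notin> {a, b, c} \<Longrightarrow> A c x = (A a x \<noteq> A b x)"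
    "x \<in> V \<Longrightarrow> y \<in> V \<Longrightarrow> y \<notin> {a, b, c} \<Longrightarrow> A' x y = A x y"
    "A' a b = (\<not> A a b)" "A' a c = (\<not> A a c)" "A' b c = (\<not> A b c)"

lemma triangle_move_swap:
  assumes "triangle_move A A' V a b c"
  shows "triangle_move A A' V b a c" "triangle_move A A' V a c b"
proof -
  note t = triangle_move.triangle[OF assms]
  have "A c x = (A b x \<noteq> A a x)" if "x \<in> V" "x \<notin> {b, a, c}" for x
    using t(9)[of x] that by auto
  moreover have "A' x y = A x y" if "x \<in> V" "y \<in> V" "y \<notin> {b, a, c}" for x y
    using t(10)[of x y] that by auto
  moreover have "A' b a = (\<not> A b a)" using t(7)[of a b] t(8)[of a b] t(11) by simp
  ultimately show "triangle_move A A' V b a c"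
    by (rule triangle_move.intro[OF t(1)[symmetric] t(3,2,5,4,6,7,8) _ _ _ t(13,12)])
  have "A b x = (A a x \<noteq> A c x)" if "x \<in> V" "x \<notin> {a, c, b}" for x
    using t(9)[of x] that by auto
  moreover have "A' x y = A x y" if "x \<in> V" "y \<in> V" "y \<notin> {a, c, b}" for x y
    using t(10)[of x y] that by auto
  moreover have "A' c b = (\<not> A c b)" using t(7)[of c b] t(8)[of c b] t(13) by simp
  ultimately show "triangle_move A A' V a c b"
    by (intro triangle_move.intro[OF t(2,1) t(3)[symmetric] t(4,6,5,7,8) _ _ t(12,11)])
qed

context pattern
begin

text \<open>The condition on \<open>a\<close> says that the rows of \<open>a\<close>,
  \<open>b\<close>, \<open>c\<close> sum to 1 in column \<open>a\<close>. The base change then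
  exchanges the diagonal entries at \<open>b\<close> and \<open>c\<close> and adds the one at
  \<open>a\<close> to both.\<close>

lemma realizes_triangle_move:
  assumes tri: "triangle_move A A' V a b c"
    and E: "finite E" "a \<in> E" "E \<inter> S = {}" "E \<union> S \<subseteq> V"
    and bc: "{b, c} \<subseteq> E \<or> {b, c} \<inter> E = {}"
    and D: "a \<in> D \<longleftrightarrow> A a b = A a c" "a \<in> D' \<longleftrightarrow> a \<in> D" "D - {a, b, c} = D' - {a, b, c}"
      "b \<in> E \<Longrightarrow> b \<in> D' \<longleftrightarrow> (c \<in> D \<longleftrightarrow> a \<notin> D)" "b \<in> E \<Longrightarrow> c \<in> D' \<longleftrightarrow> (b \<in> D \<longleftrightarrow> a \<notin> D)"
  shows "realizes (state_matrix A' D') E S =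
    realizes (state_matrix A D) E (id(b := c, c := b) ` S)"
proof -
  let ?M = "state_matrix A D" and ?M' = "state_matrix A' D'"
  note t = triangle_move.triangle[OF tri]
  have n: "a \<noteq> b" "a \<noteq> c" "b \<noteq> c" using t(1-3) by auto
  have sA: "A p q = A q p" "A' p q = A' q p" for p q by (rule t(7), rule t(8))
  have sym: "?M p q = ?M q p" "?M' p q = ?M' q p" for p q
    using sA[of p q] by (auto simp: state_matrix_def)
  have out: "?M c x = ?M a x + ?M b x" if x: "x \<in> E \<union> S - {a, b, c}" for x
  proof -
    have "A c x = (A a x \<noteq> A b x)" using t(9)[of x] x E by auto
    moreover have "a \<noteq> x" "b \<noteq> x" "c \<noteq> x" using x by auto
    ultimately show ?thesis by (cases "A a x"; cases "A b x") (simp_all add: state_matrix_def)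
  qed
  have diag: "?M a a = ?M a b + ?M a c + 1"
    using D(1) n by (cases "A a b"; cases "A a c") (simp_all add: state_matrix_def)
  have same: "?M' x y = ?M x y" if x: "x \<in> E \<union> S" and y: "y \<in> E \<union> S - {a, b, c}" for x y
  proof -
    have "A' x y = A x y" using t(10)[of x y] x y E by auto
    moreover have "y \<in> D' \<longleftrightarrow> y \<in> D" using D(3) y by blast
    ultimately show ?thesis by (simp add: state_matrix_def)
  qed
  have diff: "?M' a b = ?M a b + 1" "?M' a c = ?M a c + 1" "?M' b c = ?M b c + 1"
    using t(1-3,11-13) by (simp_all add: state_matrix_def)
  have loops: "?M' a a = ?M a a" "b \<in> E \<Longrightarrow> ?M' b b = ?M c c + ?M a a"
    "b \<in> E \<Longrightarrow> ?M' c c = ?M b b + ?M a a"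
    using D by (simp_all add: state_matrix_def)
  show ?thesis
    by (rule realizes_triangle[OF E(1-3) n bc sym out diag same diff loops])
qed

text \<open>One of the two diagonal entries at \<open>a\<close> admits the base change with pivot
  \<open>a\<close>, which matches the subsets by exchanging \<open>b\<close> and \<open>c\<close>.
  For the other, the row of \<open>c\<close> is that of \<open>b\<close> plus that of
  \<open>a\<close> in column \<open>a\<close> too; then \<open>b\<close> and \<open>c\<close> are
  twins modulo \<open>E\<close> before and after the move, and both sums reduce to subsets avoiding
  them, where the matrices agree.\<close>

lemma state_sum_triangle_odd:
  assumes tri: "triangle_move A A' V a b c"
    and ER: "finite E" "finite R" "E \<inter> R = {}" "E \<union> R = V" and abc: "a \<in> E" "b \<in> R" "c \<in> R"
  shows "state_sum A E R = state_sum A' E R"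
  unfolding state_sum_def
proof (rule sum.cong[OF refl])
  fix D assume D: "D \<in> Pow E"
  note t = triangle_move.triangle[OF tri]
  have n: "a \<noteq> b" "a \<noteq> c" "b \<noteq> c" using t(1-3) by auto
  have sA: "A p q = A q p" "A' p q = A' q p" for p q by (rule t(7), rule t(8))
  have nD: "b \<notin> D" "c \<notin> D" "b \<notin> E" "c \<notin> E" using D ER abc by auto
  show "(\<Sum>S\<in>Pow R. of_bool (realizes (state_matrix A D) E S)) =
    (\<Sum>S\<in>Pow R. of_bool (realizes (state_matrix A' D) E S) :: bit)"
  proof (cases "a \<in> D \<longleftrightarrow> A a b = A a c")
    case True
    define \<pi> where "\<pi> = id(b := c, c := b)"
    have R: "\<pi> ` R = R" using abc by (auto simp: \<pi>_def image_iff)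
    have "realizes (state_matrix A' D) E S = realizes (state_matrix A D) E (\<pi> ` S)"
      if "S \<in> Pow R" for S
      unfolding \<pi>_def
      by (rule realizes_triangle_move[OF tri]) (use ER abc nD that True in auto)
    then have "(\<Sum>S\<in>Pow R. of_bool (realizes (state_matrix A' D) E S) :: bit) =
      (\<Sum>S\<in>Pow R. of_bool (realizes (state_matrix A D) E (\<pi> ` S)))"
      by (intro sum.cong refl) simp
    also have "\<dots> = (\<Sum>S\<in>Pow (\<pi> ` R). of_bool (realizes (state_matrix A D) E S))"
      by (rule sum_Pow_image[symmetric]) (auto simp: \<pi>_def inj_on_def)
    finally show ?thesis unfolding R by (rule sym)
  next
    case False
    define R0 where "R0 = R - {b, c}"
    have R: "R = insert b (insert c R0)" and R0: "finite R0" "b \<notin> R0" "c \<notin> R0"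
      using abc ER by (auto simp: R0_def)
    have twins: "(\<Sum>S\<in>Pow R. of_bool (realizes (state_matrix B D) E S)) =
        (\<Sum>S\<in>Pow R0. of_bool (realizes (state_matrix B D) E S) :: bit)"
      if B: "\<And>p q. B p q = B q p" "\<And>x. x \<in> V \<Longrightarrow> x \<notin> {a, b, c} \<Longrightarrow> B c x = (B a x \<noteq> B b x)"
        "a \<in> D \<longleftrightarrow> B a b \<noteq> B a c" for B
      unfolding R
    proof (rule sum_twins[where Y = "\<lambda>x. of_bool (x = a)"])
      note sB = B(1)
      show "state_matrix B D p q = state_matrix B D q p" for p q
        using sB[of p q] by (auto simp: state_matrix_def)
      fix q assume q: "q \<in> E \<union> R0"
      have "lin (state_matrix B D) E (\<lambda>x. of_bool (x = a)) q =
          (\<Sum>x\<in>E. if x = a then state_matrix B D x q else 0)"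
        unfolding lin_def by (rule sum.cong) auto
      then have l: "lin (state_matrix B D) E (\<lambda>x. of_bool (x = a)) q = state_matrix B D a q"
        using ER abc by simp
      have qn: "q \<noteq> b" "q \<noteq> c" using q R0 nD by auto
      show "state_matrix B D c q = state_matrix B D b q +
          lin (state_matrix B D) E (\<lambda>x. of_bool (x = a)) q"
      proof (cases "q = a")
        case True
        then show ?thesis
          unfolding l using n B(3) sB[of c a] sB[of b a] by (simp add: state_matrix_def)
      next
        case False
        then have "B c q = (B a q \<noteq> B b q)" using B(2)[of q] qn q ER R by auto
        then show ?thesis unfolding l using qn False by (simp add: state_matrix_def)
      qed
    qed (use n ER abc R0 nD R in auto)
    have out': "A' c x = (A' a x \<noteq> A' b x)" if "x \<in> V" "x \<notin> {a, b, c}" for x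
      using t(9)[of x] t(10)[of _ x] t(4-6) that by simp
    have "(\<Sum>S\<in>Pow R. of_bool (realizes (state_matrix A D) E S)) =
        (\<Sum>S\<in>Pow R0. of_bool (realizes (state_matrix A D) E S) :: bit)"
      by (rule twins[OF t(7,9)]) (use False in auto)
    also have "\<dots> = (\<Sum>S\<in>Pow R0. of_bool (realizes (state_matrix A' D) E S))"
    proof (rule sum.cong[OF refl])
      fix S assume S: "S \<in> Pow R0"
      have "realizes (state_matrix A D) E S = realizes (state_matrix A' D) E S"
      proof (rule realizes_cong)
        fix p q assume p: "p \<in> E \<union> S" and q: "q \<in> E \<union> S"
        have V: "p \<in> V" "q \<in> V" "p \<noteq> b" "p \<noteq> c" "q \<noteq> b" "q \<noteq> c" using p q S R0 R ER nD by auto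
        show "state_matrix A D p q = state_matrix A' D p q"
        proof (cases "q = a")
          case True
          have "p \<noteq> a \<Longrightarrow> A' q p = A q p" using t(10)[of q p] V by auto
          then show ?thesis using True sA(1)[of p q] sA(2)[of p q] by (auto simp: state_matrix_def)
        next
          case False
          then have "A' p q = A p q" using t(10)[of p q] V by auto
          then show ?thesis by (simp add: state_matrix_def)
        qed
      qed (use S ER R in auto)
      then show "(of_bool (realizes (state_matrix A D) E S) :: bit) =
          of_bool (realizes (state_matrix A' D) E S)" by simp
    qed
    also have "\<dots> = (\<Sum>S\<in>Pow R. of_bool (realizes (state_matrix A' D) E S))"
      by (rule twins[OF t(8) out', symmetric]) (use t(11-13) False in auto)
    finally show ?thesis .
  qed
qed

text \<open>The sum of the three rows vanishes outside the triangle, so a state is classified by its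
  values at \<open>a\<close>, \<open>b\<close>, \<open>c\<close>. If all are 0, that sum exhibits a
  kernel vector. Wherever a value is 1, the corresponding vertex can be the pivot of a base change;
  a state with several values 1 has several partners.\<close>

lemma state_sum_triangle_even:
  assumes tri: "triangle_move A A' V a b c"
    and ER: "finite E" "E \<inter> R = {}" "E \<union> R = V" and abc: "a \<in> E" "b \<in> E" "c \<in> E"
  shows "state_sum A E R = state_sum A' E R"
proof -
  define E0 where "E0 = E - {a, b, c}"
  note t = triangle_move.triangle[OF tri]
  have n: "a \<noteq> b" "a \<noteq> c" "b \<noteq> c" using t(1-3) by auto
  have sA: "A p q = A q p" for p q by (rule t(7))
  have E: "E = insert a (insert b (insert c E0))" and E0: "finite E0" "a \<notin> E0" "b \<notin> E0" "c \<notin> E0"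
    using abc ER by (auto simp: E0_def)
  \<comment> \<open>Off-diagonal contributions to the row sums. Each combines two toggled
    adjacencies, so the move does not change them and the same coordinates serve both
    matrices.\<close>
  define k l m where "k = (A a b \<noteq> A a c)" and "l = (A a b \<noteq> A b c)" and "m = (A a c \<noteq> A b c)"
  \<comment> \<open>The bits \<open>s, t, u\<close> are the entries at \<open>a, b, c\<close> of the sum of the rows of \<open>a, b, c\<close>.\<close>
  define D where "D D0 s t u = D0 \<union> {x. x = a \<and> s \<noteq> k \<or> x = b \<and> t \<noteq> l \<or> x = c \<and> u \<noteq> m}"
    for D0 :: "'a set" and s t u
  have expand: "state_sum B E R = (\<Sum>D0\<in>Pow E0. \<Sum>S\<in>Pow R. cube_sum (\<lambda>s t u.
      of_bool (realizes (state_matrix B (D D0 s t u)) E S)))" for B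
  proof -
    have "state_sum B E R = (\<Sum>D0\<in>Pow E0. cube_sum (\<lambda>s t u. \<Sum>S\<in>Pow R.
        of_bool (realizes (state_matrix B (D0 \<union> {x. x = a \<and> s \<or> x = b \<and> t \<or> x = c \<and> u})) E S)))"
      unfolding state_sum_def
      by (subst E, subst sum_Pow_insert3) (use E0 n in \<open>simp_all flip: E\<close>)
    also have "\<dots> = (\<Sum>D0\<in>Pow E0. cube_sum (\<lambda>s t u. \<Sum>S\<in>Pow R.
        of_bool (realizes (state_matrix B (D D0 s t u)) E S)))"
      unfolding D_def by (intro sum.cong refl cube_sum_shift[symmetric])
    also have "\<dots> = (\<Sum>D0\<in>Pow E0. \<Sum>S\<in>Pow R. cube_sum (\<lambda>s t u.
        of_bool (realizes (state_matrix B (D D0 s t u)) E S)))"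
      unfolding cube_sum_def sum.distrib ..
    finally show ?thesis .
  qed
  have "cube_sum (\<lambda>s t u. of_bool (realizes (state_matrix A (D D0 s t u)) E S)) =
      cube_sum (\<lambda>s t u. of_bool (realizes (state_matrix A' (D D0 s t u)) E S) :: bit)"
    if D0: "D0 \<in> Pow E0" and S: "S \<in> Pow R" for D0 S
  proof -
    let ?H = "\<lambda>s t u. realizes (state_matrix A (D D0 s t u)) E S"
    let ?H' = "\<lambda>s t u. realizes (state_matrix A' (D D0 s t u)) E S"
    have aD: "a \<in> D D0 s t u \<longleftrightarrow> s \<noteq> k" "b \<in> D D0 s t u \<longleftrightarrow> t \<noteq> l" "c \<in> D D0 s t u \<longleftrightarrow> u \<noteq> m"
      and D0D: "D D0 s t u - {a, b, c} = D0"
      for s t u using D0 E0 n by (auto simp: D_def)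
    have nS: "a \<notin> S" "b \<notin> S" "c \<notin> S" using S abc ER by auto
    have idS: "id(x := y, y := x) ` S = S" if "x \<notin> S" "y \<notin> S" for x y :: 'a
      using that by (auto simp: image_iff)
    have D0s: "D D0 s t u - {b, a, c} = D0" "D D0 s t u - {c, a, b} = D0" for s t u
      using D0D by (simp_all add: insert_commute)
    have ES: "E \<inter> S = {}" "E \<union> S \<subseteq> V" using S ER by auto
    have 1: "?H' True (\<not> u) (\<not> t) = ?H True t u" for t u
      using realizes_triangle_move[OF tri, of E S "D D0 True t u" "D D0 True (\<not> u) (\<not> t)"]
        ER abc ES
      unfolding idS[OF nS(2,3)] aD D0D k_def l_def m_def by auto
    have 2: "?H' (\<not> u) True (\<not> s) = ?H s True u" for s u
      using realizes_triangle_move[OF triangle_move_swap(1)[OF tri], of E S "D D0 s True u"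
          "D D0 (\<not> u) True (\<not> s)"]
        ER abc ES sA[of b a]
      unfolding idS[OF nS(1,3)] aD D0s k_def l_def m_def by auto
    have 3: "?H' (\<not> t) (\<not> s) True = ?H s t True" for s t
      using realizes_triangle_move[OF triangle_move_swap(1)[OF triangle_move_swap(2)[OF tri]],
          of E S "D D0 s t True" "D D0 (\<not> t) (\<not> s) True"]
        ER abc ES sA[of c a] sA[of c b]
      unfolding idS[OF nS(1,2)] aD D0s k_def l_def m_def by auto
    have 0: "\<not> realizes (state_matrix B (D D0 False False False)) E S"
      if B: "\<And>p q. B p q = B q p" "\<And>x. x \<in> V \<Longrightarrow> x \<notin> {a, b, c} \<Longrightarrow> B c x = (B a x \<noteq> B b x)"
        "(B a b \<noteq> B a c) = k" "(B a b \<noteq> B b c) = l" "(B a c \<noteq> B b c) = m" for B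
    proof (rule not_realizes_kernel[where X = "\<lambda>x. of_bool (x = a \<or> x = b \<or> x = c)" and e = a])
      let ?M = "state_matrix B (D D0 False False False)"
      note sB = B(1)
      show "\<forall>e\<in>E. lin ?M E (\<lambda>x. of_bool (x = a \<or> x = b \<or> x = c)) e = 0"
      proof
        fix e assume e: "e \<in> E"
        have z: "lin ?M E0 (\<lambda>x. of_bool (x = a \<or> x = b \<or> x = c)) e = 0"
          unfolding lin_def by (rule sum.neutral) (use E0 in auto)
        have "lin ?M E (\<lambda>x. of_bool (x = a \<or> x = b \<or> x = c)) e = ?M a e + (?M b e + ?M c e)"
          unfolding E using E0 n z by (simp add: lin_insert)
        also have "\<dots> = 0"
        proof (cases "e \<in> {a, b, c}")
          case True
          then show ?thesis
            using n aD[of False False False] B(3-5) sB[of b a] sB[of c a] sB[of c b]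
            by (elim insertE emptyE; hypsubst) (auto simp: state_matrix_def)
        next
          case False
          then have "B c e = (B a e \<noteq> B b e)" using B(2)[of e] e ER by auto
          moreover have "a \<noteq> e" "b \<noteq> e" "c \<noteq> e" using False by auto
          ultimately show ?thesis by (cases "B a e"; cases "B b e") (simp_all add: state_matrix_def)
        qed
        finally show "lin ?M E (\<lambda>x. of_bool (x = a \<or> x = b \<or> x = c)) e = 0" .
      qed
    qed (use abc in auto)
    have "\<not> ?H False False False"
      by (rule 0[OF t(7,9)]) (auto simp: k_def l_def m_def)
    moreover have out': "A' c x = (A' a x \<noteq> A' b x)" if "x \<in> V" "x \<notin> {a, b, c}" for x
      using t(9)[of x] t(10)[of _ x] t(4-6) that by simp
    have "\<not> ?H' False False False"
      by (rule 0[OF t(8) out']) (use t(11-13) in \<open>auto simp: k_def l_def m_def\<close>)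
    \<comment> \<open>States with two values 1 match themselves. The state 111 on one side equals
      each of 100, 010 and 001 on the other; three equal terms count as one modulo 2.\<close>
    ultimately show ?thesis
      using 1[of True True] 1[of True False] 1[of False True] 1[of False False]
        2[of True True] 2[of True False] 2[of False True] 2[of False False]
        3[of True True] 3[of True False] 3[of False True] 3[of False False]
      by (simp add: cube_sum_def algebra_simps)
  qed
  then show ?thesis unfolding expand by (intro sum.cong refl)
qed

end

section \<open>The bracket and its invariance\<close>

definition degree2 :: "('v \<Rightarrow> 'v \<Rightarrow> bool) \<Rightarrow> 'v set \<Rightarrow> 'v \<Rightarrow> bit" where
  "degree2 A V v = (\<Sum>u\<in>V - {v}. of_bool (A v u))"

definition odd_set :: "('v \<Rightarrow> 'v \<Rightarrow> bool) \<Rightarrow> 'v set \<Rightarrow> 'v set" where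
  "odd_set A V = {v \<in> V. degree2 A V v = 1}"

text \<open>The link between degrees as bits, which add when vertices are inserted, and the
  cardinalities defining odd vertices.\<close>

lemma degree2_eq_1_iff:
  assumes "finite V"
  shows "degree2 A V v = 1 \<longleftrightarrow> odd (card {u \<in> V. u \<noteq> v \<and> A v u})"
proof -
  have "degree2 A V v = of_nat (card ((V - {v}) \<inter> {u. A v u}))"
    unfolding degree2_def using assms by (simp add: sum_of_bool_eq)
  also have "(V - {v}) \<inter> {u. A v u} = {u \<in> V. u \<noteq> v \<and> A v u}" by auto
  moreover have "of_nat n = (1::bit) \<longleftrightarrow> odd n" for n
  proof (induction n)
    case (Suc n)
    then show ?case by (cases "of_nat n :: bit") auto
  qed simp
  ultimately show ?thesis by simp
qed

lemma degree2_insert: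
  assumes "finite V" "e \<notin> V" "v \<noteq> e"
  shows "degree2 A (insert e V) v = of_bool (A v e) + degree2 A V v"
  using assms by (simp add: degree2_def insert_Diff_if)

lemma degree2_insert_self:
  assumes "e \<notin> V"
  shows "degree2 A (insert e V) e = (\<Sum>u\<in>V. of_bool (A e u))"
  using assms by (simp add: degree2_def)

lemma degree2_cong:
  assumes "\<And>u. u \<in> V \<Longrightarrow> u \<noteq> v \<Longrightarrow> A v u = A' v u"
  shows "degree2 A V v = degree2 A' V v"
  unfolding degree2_def by (rule sum.cong) (use assms in auto)

context pattern
begin

definition bracket :: "('v \<Rightarrow> 'v \<Rightarrow> bool) \<Rightarrow> 'v set \<Rightarrow> bit" where
  "bracket A V = state_sum A (V - odd_set A V) (odd_set A V)"

lemma bracket_cong: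
  assumes "\<And>p q. p \<in> V \<Longrightarrow> q \<in> V \<Longrightarrow> p \<noteq> q \<Longrightarrow> A p q = A' p q"
  shows "bracket A V = bracket A' V"
proof -
  have "odd_set A V = odd_set A' V"
    using assms degree2_cong[of V _ A A'] by (auto simp: odd_set_def)
  then show ?thesis
    unfolding bracket_def by (simp, intro state_sum_cong) (use assms in \<open>auto simp: odd_set_def\<close>)
qed

lemma bracket_relabel:
  assumes inj: "inj_on \<pi> V"
  shows "bracket A (\<pi> ` V) = bracket (\<lambda>p q. A (\<pi> p) (\<pi> q)) V"
proof -
  let ?A = "\<lambda>p q. A (\<pi> p) (\<pi> q)"
  have "degree2 A (\<pi> ` V) (\<pi> v) = degree2 ?A V v" if "v \<in> V" for v
  proof -
    have "\<pi> ` V - {\<pi> v} = \<pi> ` (V - {v})" using inj that by (auto simp: inj_on_def)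
    moreover have "inj_on \<pi> (V - {v})" using inj by (rule inj_on_subset) auto
    ultimately show ?thesis by (simp add: degree2_def sum.reindex)
  qed
  then have odd: "odd_set A (\<pi> ` V) = \<pi> ` odd_set ?A V"
    by (auto simp: odd_set_def)
  have even: "\<pi> ` V - \<pi> ` odd_set ?A V = \<pi> ` (V - odd_set ?A V)"
    by (rule inj_on_image_set_diff[OF inj, symmetric]) (auto simp: odd_set_def)
  have *: "V - odd_set ?A V \<union> odd_set ?A V = V" by (auto simp: odd_set_def)
  show ?thesis
    unfolding bracket_def odd even
    by (rule state_sum_relabel) (use inj * in \<open>simp_all del: Un_Diff_cancel2\<close>, auto)
qed

lemma bracket_isolated:
  assumes V: "finite V" "e \<notin> V" and A: "\<And>x. x \<in> V \<Longrightarrow> \<not> A e x \<and> \<not> A x e"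
  shows "bracket A (insert e V) = bracket A V"
proof -
  have "degree2 A (insert e V) v = degree2 A V v" if "v \<in> V" for v
    using that V A[of v] degree2_insert[of V e v A] by auto
  moreover have "degree2 A (insert e V) e = 0"
    unfolding degree2_insert_self[OF V(2)] by (rule sum.neutral) (use A in auto)
  ultimately have odd: "odd_set A (insert e V) = odd_set A V"
    by (auto simp: odd_set_def)
  have oV: "odd_set A V \<subseteq> V" by (auto simp: odd_set_def)
  then have even: "insert e V - odd_set A V = insert e (V - odd_set A V)" using V by auto
  show ?thesis
    unfolding bracket_def odd even by (rule state_sum_isolated) (use V A oV in auto)
qed

text \<open>Every other vertex sees both twins or neither, so its parity is kept. The twins have
  equal degrees, as a possible adjacency between them counts once for each; hence both are odd or
  both even.\<close>

lemma bracket_twins: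
  assumes V: "finite V" "a \<notin> V" "b \<notin> V" "a \<noteq> b" and sym: "\<And>p q. A p q = A q p"
    and A: "\<And>x. x \<in> V \<Longrightarrow> A b x = A a x"
  shows "bracket A (insert a (insert b V)) = bracket A V"
proof -
  let ?V = "insert a (insert b V)"
  have V': "finite (insert b V)" "finite (insert a V)" "?V = insert b (insert a V)" using V by auto
  have deg: "degree2 A ?V v = degree2 A V v" if "v \<in> V" for v
  proof -
    have "v \<noteq> a" "v \<noteq> b" "a \<notin> insert b V" using that V by auto
    then have "degree2 A ?V v = of_bool (A v a) + (of_bool (A v b) + degree2 A V v)"
      using degree2_insert[OF V'(1), of a v A] degree2_insert[OF V(1,3), of v A] by simp
    then show ?thesis using A[OF that] sym[of v a] sym[of v b] by simp
  qed
  have "degree2 A ?V a = of_bool (A a b) + (\<Sum>u\<in>V. of_bool (A a u))"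
    using V by (subst degree2_insert_self) auto
  moreover have "degree2 A ?V b = of_bool (A b a) + (\<Sum>u\<in>V. of_bool (A b u))"
    unfolding V'(3) using V by (subst degree2_insert_self) auto
  moreover have "(\<Sum>u\<in>V. of_bool (A b u)) = (\<Sum>u\<in>V. of_bool (A a u) :: bit)"
    by (rule sum.cong) (use A in auto)
  ultimately have ab: "degree2 A ?V b = degree2 A ?V a" using sym[of a b] by simp
  have oV: "odd_set A V \<subseteq> V" by (auto simp: odd_set_def)
  show ?thesis
  proof (cases "degree2 A ?V a = 1")
    case True
    then have odd: "odd_set A ?V = insert a (insert b (odd_set A V))"
      using ab deg by (auto simp: odd_set_def)
    have even: "?V - insert a (insert b (odd_set A V)) = V - odd_set A V" using V oV by auto
    show ?thesis
      unfolding bracket_def odd even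
      by (rule state_sum_odd_twins[OF _ _ _ _ _ _ sym])
        (use V oV A in \<open>auto intro: finite_subset\<close>)
  next
    case False
    then have odd: "odd_set A ?V = odd_set A V"
      using ab deg V by (auto simp: odd_set_def)
    have even: "?V - odd_set A V = insert a (insert b (V - odd_set A V))" using V oV by auto
    show ?thesis
      unfolding bracket_def odd even
      by (rule state_sum_even_twins[OF _ _ _ _ _ sym]) (use V oV A in auto)
  qed
qed

text \<open>Each of the three vertices has two adjacencies toggled, so parities do not change. The
  row condition makes the three degrees sum to zero, as every adjacency inside the triangle counts
  twice; this leaves three even vertices or exactly one, which is then taken as pivot.\<close>

lemma bracket_triangle:
  assumes tri: "triangle_move A A' V a b c" and V: "finite V"
  shows "bracket A V = bracket A' V"
proof -
  note t = triangle_move.triangle[OF tri]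
  define R where "R = V - {a, b, c}"
  have R: "V = insert a (insert b (insert c R))" "finite R" "a \<notin> R" "b \<notin> R" "c \<notin> R"
    using t(4-6) V by (auto simp: R_def)
  have rest: "degree2 A' V v = degree2 A V v" if "v \<in> V" "v \<notin> {a, b, c}" for v
  proof (rule degree2_cong)
    fix u assume "u \<in> V"
    then show "A' v u = A v u" using t(10)[of u v] that t(7)[of u v] t(8)[of u v] by simp
  qed
  have row: "(\<Sum>u\<in>R. of_bool (A' x u)) = (\<Sum>u\<in>R. of_bool (A x u) :: bit)" if "x \<in> V" for x
    by (rule sum.cong) (use t(10)[of x] that in \<open>auto simp: R_def\<close>)
  have deg: "degree2 B V a = of_bool (B a b) + (of_bool (B a c) + (\<Sum>u\<in>R. of_bool (B a u)))"
    "degree2 B V b = of_bool (B b a) + (of_bool (B b c) + (\<Sum>u\<in>R. of_bool (B b u)))"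
    "degree2 B V c = of_bool (B c a) + (of_bool (B c b) + (\<Sum>u\<in>R. of_bool (B c u)))"
    for B
  proof -
    have "V - {a} = insert b (insert c R)" "V - {b} = insert a (insert c R)"
      "V - {c} = insert a (insert b R)" using R t(1-3) by auto
    then show "degree2 B V a = of_bool (B a b) + (of_bool (B a c) + (\<Sum>u\<in>R. of_bool (B a u)))"
    "degree2 B V b = of_bool (B b a) + (of_bool (B b c) + (\<Sum>u\<in>R. of_bool (B b u)))"
    "degree2 B V c = of_bool (B c a) + (of_bool (B c b) + (\<Sum>u\<in>R. of_bool (B c u)))"
      using R t(1-3) by (simp_all add: degree2_def)
  qed
  have not: "of_bool (\<not> P) = 1 + (of_bool P :: bit)" for P by (cases P) simp_all
  have abc: "degree2 A' V a = degree2 A V a" "degree2 A' V b = degree2 A V b"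
    "degree2 A' V c = degree2 A V c"
    unfolding deg row[OF t(4)] row[OF t(5)] row[OF t(6)]
      t(8)[of b a] t(8)[of c a] t(8)[of c b] t(11-13) t(7)[of b a] t(7)[of c a] t(7)[of c b] not
    by (simp_all add: ac_simps)
  have "(\<Sum>u\<in>R. of_bool (A c u)) = (\<Sum>u\<in>R. of_bool (A a u) + of_bool (A b u) :: bit)"
  proof (rule sum.cong[OF refl])
    fix u assume "u \<in> R"
    then have "A c u = (A a u \<noteq> A b u)" using t(9)[of u] by (auto simp: R_def)
    then show "of_bool (A c u) = of_bool (A a u) + (of_bool (A b u) :: bit)"
      by (cases "A a u"; cases "A b u") simp_all
  qed
  then have sum: "degree2 A V c = degree2 A V a + degree2 A V b"
    unfolding deg t(7)[of b a] t(7)[of c a] t(7)[of c b] sum.distrib by (simp add: ac_simps)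
  have odd: "odd_set A' V = odd_set A V"
    unfolding odd_set_def
  proof (rule Collect_cong, rule conj_cong[OF refl])
    fix v assume "v \<in> V"
    then show "(degree2 A' V v = 1) = (degree2 A V v = 1)"
      using rest[of v] abc by (cases "v \<in> {a, b, c}") auto
  qed
  have fin: "finite (V - odd_set A V)" "finite (odd_set A V)" "(V - odd_set A V) \<inter> odd_set A V = {}"
    "V - odd_set A V \<union> odd_set A V = V"
    using V by (auto simp: odd_set_def)
  have mem: "x \<in> V - odd_set A V \<longleftrightarrow> degree2 A V x = 0" "x \<in> odd_set A V \<longleftrightarrow> degree2 A V x = 1"
    if "x \<in> V" for x using that by (auto simp: odd_set_def)
  note tri' = triangle_move_swap[OF tri]
  note tri'' = triangle_move_swap(1)[OF tri'(2)]
  show ?thesis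
    unfolding bracket_def odd
  proof (cases "degree2 A V a"; cases "degree2 A V b")
    assume "degree2 A V a = 0" "degree2 A V b = 0"
    then show "state_sum A (V - odd_set A V) (odd_set A V) = state_sum A' (V - odd_set A V) (odd_set A V)"
      using state_sum_triangle_even[OF tri fin(1,3,4)] mem[OF t(4)] mem[OF t(5)] mem[OF t(6)] sum
      by simp
  next
    assume "degree2 A V a = 0" "degree2 A V b = 1"
    then show "state_sum A (V - odd_set A V) (odd_set A V) = state_sum A' (V - odd_set A V) (odd_set A V)"
      using state_sum_triangle_odd[OF tri fin] mem[OF t(4)] mem[OF t(5)] mem[OF t(6)] sum
      by simp
  next
    assume "degree2 A V a = 1" "degree2 A V b = 0"
    then show "state_sum A (V - odd_set A V) (odd_set A V) = state_sum A' (V - odd_set A V) (odd_set A V)"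
      using state_sum_triangle_odd[OF tri'(1) fin] mem[OF t(4)] mem[OF t(5)] mem[OF t(6)] sum
      by simp
  next
    assume "degree2 A V a = 1" "degree2 A V b = 1"
    then show "state_sum A (V - odd_set A V) (odd_set A V) = state_sum A' (V - odd_set A V) (odd_set A V)"
      using state_sum_triangle_odd[OF tri'' fin] mem[OF t(4)] mem[OF t(5)] mem[OF t(6)] sum
      by simp
  qed
qed

text \<open>With no even vertices there is one state, on the empty block, and only the full set is
  large enough to be in bijection with \<open>W\<close>.\<close>

lemma bracket_pattern:
  assumes "odd_set C W = W"
  shows "bracket C W = 1"
proof -
  have "realizes (state_matrix C {}) {} S \<longleftrightarrow> S = W" if "S \<in> Pow W" for S
  proof
    assume "realizes (state_matrix C {}) {} S"
    then obtain f where "bij_betw f S W" unfolding realizes_def by blast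
    then have "card S = card W" by (rule bij_betw_same_card)
    then show "S = W" using that finite_W by (metis PowD card_subset_eq)
  next
    assume "S = W"
    then show "realizes (state_matrix C {}) {} S"
      unfolding realizes_def regular_def
      by (intro conjI exI[of _ id]) (auto simp: lin_def state_matrix_def)
  qed
  then have "(\<Sum>S\<in>Pow W. of_bool (realizes (state_matrix C {}) {} S)) =
      (\<Sum>S\<in>Pow W. if S = W then 1 else 0 :: bit)"
    by (intro sum.cong refl) simp
  then show ?thesis
    using finite_W by (simp add: bracket_def assms state_sum_def)
qed

lemma card_le_of_bracket:
  assumes "finite V" "bracket A V = 1"
  shows "card W \<le> card V"
proof -
  have "\<exists>D \<in> Pow (V - odd_set A V). (\<Sum>S\<in>Pow (odd_set A V).
      of_bool (realizes (state_matrix A D) (V - odd_set A V) S)) \<noteq> (0::bit)"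
    using assms(2) unfolding bracket_def state_sum_def by (metis (lifting) sum.neutral zero_neq_one)
  then obtain D where "(\<Sum>S\<in>Pow (odd_set A V).
      of_bool (realizes (state_matrix A D) (V - odd_set A V) S)) \<noteq> (0::bit)" by blast
  then obtain S where S: "S \<in> Pow (odd_set A V)"
    and "of_bool (realizes (state_matrix A D) (V - odd_set A V) S) \<noteq> (0::bit)"
    by (rule sum.not_neutral_contains_not_neutral)
  then obtain f where "bij_betw f S W"
    unfolding realizes_def by fastforce
  then have "card W = card S" by (simp add: bij_betw_same_card)
  also have "card S \<le> card V"
    by (rule card_mono) (use S assms in \<open>auto simp: odd_set_def\<close>)
  finally show ?thesis .
qed

end

section \<open>Linked letters in double occurrence words\<close>

lemma count_list_2_split:
  assumes "count_list w a = 2"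
  obtains x y z where "w = x @ a # y @ a # z" "a \<notin> set x" "a \<notin> set y" "a \<notin> set z"
proof -
  have "a \<in> set w" using assms by (metis count_notin zero_neq_numeral)
  then obtain x u where w: "w = x @ a # u" "a \<notin> set x" by (meson split_list_first)
  then have "count_list u a = 1" using assms by simp
  then have "a \<in> set u" by (metis count_notin zero_neq_one)
  then obtain y z where u: "u = y @ a # z" "a \<notin> set y" by (meson split_list_first)
  then have "a \<notin> set z" using \<open>count_list u a = 1\<close> by (simp add: count_list_0_iff)
  then show ?thesis using that w u by simp
qed

lemma linked_sym: "linked w a b \<Longrightarrow> linked w b a"
proof -
  assume "linked w a b"
  then obtain i j k l where *: "i < j" "j < length w" "k < length w" "l < length w"
    "w ! i = a" "w ! j = a" "w ! k = b" "w ! l = b" "k \<in> {i<..<j}" "l \<notin> {i..j}"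
    unfolding linked_def by blast
  show "linked w b a"
  proof (cases "l < i")
    case True
    with * show ?thesis
      unfolding linked_def by (intro exI[of _ l] exI[of _ k] exI[of _ i] exI[of _ j]) auto
  next
    case False
    with * show ?thesis
      unfolding linked_def by (intro exI[of _ k] exI[of _ l] exI[of _ j] exI[of _ i]) auto
  qed
qed

text \<open>Since \<open>b\<close> occurs twice, having one end inside and one outside means exactly
  one end inside. This replaces positions by counts in the computations with moves.\<close>

lemma linked_iff_between:
  assumes w: "w = x @ a # y @ a # z" and a: "a \<notin> set x" "a \<notin> set y" "a \<notin> set z"
    and b: "count_list w b = 2" "b \<noteq> a"
  shows "linked w a b \<longleftrightarrow> count_list y b = 1"
proof
  have pos: "i = length x \<or> i = length x + 1 + length y" if "i < length w" "w ! i = a" for i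
  proof -
    consider "i < length x" | "i = length x" | "length x < i" "i < length x + 1 + length y"
      | "i = length x + 1 + length y" | "length x + 1 + length y < i" by linarith
    then show ?thesis
    proof cases
      case 1
      then show ?thesis using that w a by (auto simp: nth_append)
    next
      case 3
      then have "w ! i = y ! (i - length x - 1)" by (auto simp: w nth_append nth_Cons')
      moreover have "i - length x - 1 < length y" using 3 by auto
      ultimately show ?thesis using that a by (metis nth_mem)
    next
      case 5
      \<comment> \<open>Two is subtracted for the two occurrences of \<open>a\<close> preceding
        \<open>z\<close>.\<close>
      then have "w ! i = z ! (i - length x - length y - 2)"
        by (auto simp: w nth_append nth_Cons' numeral_2_eq_2)
      moreover have "i - length x - length y - 2 < length z" using 5 that w by auto
      ultimately show ?thesis using that a by (metis nth_mem)
    qed auto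
  qed
  have sum: "count_list x b + count_list y b + count_list z b = 2" using b w by simp
  {
    assume "linked w a b"
    then obtain i j k l where *: "i < j" "j < length w" "k < length w" "l < length w"
      "w ! i = a" "w ! j = a" "w ! k = b" "w ! l = b" "k \<in> {i<..<j}" "l \<notin> {i..j}"
      unfolding linked_def by blast
    then have ij: "i = length x" "j = length x + 1 + length y" using pos[of i] pos[of j] by auto
    have "w ! k = y ! (k - length x - 1)" using * ij by (auto simp: w nth_append nth_Cons')
    moreover have "k - length x - 1 < length y" using * ij by auto
    ultimately have "b \<in> set y" using * by (metis nth_mem)
    moreover have "b \<in> set x \<union> set z"
    proof (cases "l < length x")
      case True
      then have "x ! l = b" using \<open>w ! l = b\<close> by (simp add: w nth_append)
      then show ?thesis using True by (metis UnI1 nth_mem)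
    next
      case False
      then have l: "l > length x + 1 + length y" using * ij by auto
      then have "w ! l = z ! (l - length x - length y - 2)"
        by (auto simp: w nth_append nth_Cons' numeral_2_eq_2)
      moreover have "l - length x - length y - 2 < length z" using l * w by auto
      ultimately show ?thesis using * by (metis UnI2 nth_mem)
    qed
    ultimately have "count_list y b \<noteq> 0" "count_list x b \<noteq> 0 \<or> count_list z b \<noteq> 0"
      by (auto simp: count_list_0_iff)
    then show "count_list y b = 1" using sum by linarith
  }
  assume y: "count_list y b = 1"
  then have "b \<in> set y" by (metis count_notin zero_neq_one)
  then obtain k where k: "k < length y" "y ! k = b" by (auto simp: in_set_conv_nth)
  have "b \<in> set x \<union> set z"
  proof (rule ccontr)
    assume "b \<notin> set x \<union> set z"
    then show False using sum y by (simp add: count_notin)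
  qed
  then obtain l where l: "l < length w" "w ! l = b" "l \<notin> {length x..length x + 1 + length y}"
  proof
    assume "b \<in> set x"
    then obtain l where "l < length x" "x ! l = b" by (auto simp: in_set_conv_nth)
    then show ?thesis by (intro that[of l]) (auto simp: w nth_append)
  next
    assume "b \<in> set z"
    then obtain l where "l < length z" "z ! l = b" by (auto simp: in_set_conv_nth)
    then show ?thesis
      by (intro that[of "length x + length y + 2 + l"]) (auto simp: w nth_append)
  qed
  show "linked w a b"
    unfolding linked_def
    by (rule exI[of _ "length x"], rule exI[of _ "length x + 1 + length y"],
        rule exI[of _ "length x + 1 + k"], rule exI[of _ l])
      (use k l in \<open>auto simp: w nth_append\<close>)
qed

lemma linked_rev:
  assumes "count_list w a = 2" "count_list w b = 2" "a \<noteq> b"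
  shows "linked (rev w) a b = linked w a b"
proof -
  obtain x y z where w: "w = x @ a # y @ a # z" "a \<notin> set x" "a \<notin> set y" "a \<notin> set z"
    using assms(1) by (rule count_list_2_split)
  have "linked (rev w) a b \<longleftrightarrow> count_list (rev y) b = 1"
    by (rule linked_iff_between[of _ "rev z" _ _ "rev x"]) (use w assms in auto)
  moreover have "linked w a b \<longleftrightarrow> count_list y b = 1"
    by (rule linked_iff_between[OF w]) (use assms in auto)
  ultimately show ?thesis by simp
qed

text \<open>If the letter moved is \<open>a\<close> itself, the inside and the outside of its chord
  change places; as \<open>b\<close> occurs twice, one contains a single \<open>b\<close> iff the
  other does.\<close>

lemma linked_rotate1:
  assumes "count_list w a = 2" "count_list w b = 2" "a \<noteq> b"
  shows "linked (rotate1 w) a b = linked w a b"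
proof -
  obtain x y z where w: "w = x @ a # y @ a # z" "a \<notin> set x" "a \<notin> set y" "a \<notin> set z"
    using assms(1) by (rule count_list_2_split)
  have y: "linked w a b \<longleftrightarrow> count_list y b = 1"
    by (rule linked_iff_between[OF w]) (use assms in auto)
  show ?thesis
  proof (cases x)
    case Nil
    have "linked (rotate1 w) a b \<longleftrightarrow> count_list z b = 1"
      by (rule linked_iff_between[of _ y _ _ "[]"]) (use w assms Nil in auto)
    moreover have "count_list y b + count_list z b = 2" using assms w Nil by auto
    ultimately show ?thesis using y by auto
  next
    case (Cons h x')
    have "linked (rotate1 w) a b \<longleftrightarrow> count_list y b = 1"
      by (rule linked_iff_between[of _ x' _ _ "z @ [h]"]) (use w assms Cons in auto)
    then show ?thesis using y by simp
  qed
qed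

lemma count_list_rotate [simp]: "count_list (rotate m w) v = count_list w v"
proof (induction m)
  case (Suc m)
  have "count_list (rotate1 u) v = count_list u v" for u :: "'a list" by (cases u) auto
  with Suc show ?case by simp
qed simp

lemma linked_rotate:
  assumes "count_list w a = 2" "count_list w b = 2" "a \<noteq> b"
  shows "linked (rotate m w) a b = linked w a b"
proof (induction m)
  case (Suc m)
  have "linked (rotate1 (rotate m w)) a b = linked (rotate m w) a b"
    by (rule linked_rotate1) (use assms in simp_all)
  with Suc show ?case by simp
qed simp

lemma append_Cons_eq_first:
  "xs @ a # ys = xs' @ a # ys' \<Longrightarrow> a \<notin> set xs \<Longrightarrow> a \<notin> set xs' \<Longrightarrow> xs = xs' \<and> ys = ys'"
proof (induction xs arbitrary: xs')
  case Nil
  then show ?case by (cases xs') auto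
next
  case (Cons h xs)
  then show ?case by (cases xs') auto
qed

text \<open>Linking depends only on the subword in the two letters, so moves do not affect pairs
  whose subword they preserve.\<close>

lemma linked_cong_filter:
  assumes "count_list w a = 2" "count_list w b = 2" "count_list w' a = 2" "count_list w' b = 2"
    and ab: "a \<noteq> b"
    and f: "filter (\<lambda>x. x = a \<or> x = b) w = filter (\<lambda>x. x = a \<or> x = b) w'"
  shows "linked w a b = linked w' a b"
proof -
  let ?f = "filter (\<lambda>x. x = a \<or> x = b)"
  obtain x y z where w: "w = x @ a # y @ a # z" "a \<notin> set x" "a \<notin> set y" "a \<notin> set z"
    using assms(1) by (rule count_list_2_split)
  obtain x' y' z' where w': "w' = x' @ a # y' @ a # z'" "a \<notin> set x'" "a \<notin> set y'" "a \<notin> set z'"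
    using assms(3) by (rule count_list_2_split)
  have "?f x @ a # (?f y @ a # ?f z) = ?f x' @ a # (?f y' @ a # ?f z')"
    using f by (simp add: w(1) w'(1))
  from append_Cons_eq_first[OF this] have "?f y @ a # ?f z = ?f y' @ a # ?f z'"
    using w(2) w'(2) by simp
  from append_Cons_eq_first[OF this] have "?f y = ?f y'"
    using w(3) w'(3) by simp
  moreover have "count_list (?f u) b = count_list u b" for u by (induction u) auto
  ultimately have "count_list y b = count_list y' b" by metis
  moreover have "linked w a b \<longleftrightarrow> count_list y b = 1"
    by (rule linked_iff_between[OF w]) (use assms in auto)
  moreover have "linked w' a b \<longleftrightarrow> count_list y' b = 1"
    by (rule linked_iff_between[OF w']) (use assms in auto)
  ultimately show ?thesis by simp
qed

section \<open>Chord diagrams and the bracket of a graph\<close>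

lemma count_list_map_distinct:
  "distinct xs \<Longrightarrow> count_list (map f xs) v = card {x \<in> set xs. f x = v}"
proof (induction xs)
  case (Cons a xs)
  have "{x \<in> set (a # xs). f x = v} =
      (if f a = v then insert a {x \<in> set xs. f x = v} else {x \<in> set xs. f x = v})" by auto
  with Cons show ?case by auto
qed simp

locale traversed_graph = framed_4_graph G for G :: "('v, 'h) framed_graph" +
  fixes hs :: "'h list"
  assumes path: "traversing_path G hs" and nonempty: "verts G \<noteq> {}"
begin

text \<open>Periodic indexing by all natural numbers: steps forward never wrap around, and an index
  can be raised by a full period before something is subtracted from it.\<close>

definition path_at :: "nat \<Rightarrow> 'h" where
  "path_at k = hs ! (k mod length hs)"

lemma length_pos: "length hs > 0"
  using path nonempty finite_verts by (auto simp: traversing_path_def card_gt_0_iff)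

lemma path_at_in: "path_at k \<in> set hs" "path_at k \<in> halves G"
proof -
  show "path_at k \<in> set hs" unfolding path_at_def using length_pos by simp
  then show "path_at k \<in> halves G" using path by (auto simp: traversing_path_def)
qed

lemma path_at_Suc: "path_at (Suc k) = opp G (mate G (path_at k))"
proof -
  have "k mod length hs < length hs" using length_pos by simp
  then show ?thesis
    using path unfolding traversing_path_def path_at_def by (metis mod_Suc_eq)
qed

lemma path_at_periodic: "path_at (k + length hs) = path_at k"
  by (simp add: path_at_def)

lemma set_path: "h \<in> set hs \<Longrightarrow> \<exists>k. h = path_at k"
  by (metis in_set_conv_nth mod_less path_at_def)

text \<open>If the edge left at step \<open>i\<close> is run through in the other direction at step
  \<open>j\<close>, then going forward from \<open>i\<close> retraces the path backwards from
  \<open>j\<close>.\<close>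

lemma mate_path_back:
  "mate G (path_at i) = path_at j \<Longrightarrow> k \<le> j \<Longrightarrow> mate G (path_at (i + k)) = path_at (j - k)"
proof (induction k)
  case (Suc k)
  then have IH: "mate G (path_at (i + k)) = path_at (j - k)" by simp
  have j: "j - k = Suc (j - Suc k)" using Suc by simp
  have "path_at (i + Suc k) = opp G (path_at (j - k))"
    using path_at_Suc[of "i + k"] IH by simp
  also have "\<dots> = mate G (path_at (j - Suc k))"
    unfolding j path_at_Suc using path_at_in opp_opp mate_in by metis
  finally show ?case using path_at_in mate_mate by metis
qed simp

text \<open>A path running back along itself would turn around in the middle of an edge or at a vertex.\<close>

lemma mate_not_in_path:
  assumes "h \<in> set hs"
  shows "mate G h \<notin> set hs"
proof
  assume "mate G h \<in> set hs"
  then obtain i j0 where i: "h = path_at i" "i < length hs" and j0: "mate G h = path_at j0"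
    using set_path assms by (metis length_pos mod_less_divisor mod_mod_trivial path_at_def)
  \<comment> \<open>One extra period ensures \<open>i \<le> j\<close>.\<close>
  define j where "j = j0 + length hs"
  have j: "mate G (path_at i) = path_at j" "i \<le> j"
    using i j0 by (simp_all add: j_def path_at_periodic)
  \<comment> \<open>The two directions meet halfway: an even distance yields a fixed point of
    \<open>mate\<close>, an odd one a fixed point of \<open>opp\<close>.\<close>
  define k where "k = (j - i) div 2"
  have k: "mate G (path_at (i + k)) = path_at (j - k)"
    by (rule mate_path_back[OF j(1)]) (simp add: k_def)
  consider "j - k = i + k" | "j - k = Suc (i + k)" using j(2) unfolding k_def by linarith
  then show False
  proof cases
    case 1
    then show False using k path_at_in mate_neq by metis
  next
    case 2
    then show False using k path_at_Suc path_at_in mate_in opp_neq by metis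
  qed
qed

lemma card_halves: "card (halves G) = 4 * card (verts G)"
proof -
  have "halves G = (\<Union>v\<in>verts G. {h \<in> halves G. vert G h = v})" using vert_in by auto
  then have "card (halves G) = card (\<Union>v\<in>verts G. {h \<in> halves G. vert G h = v})" by simp
  also have "\<dots> = (\<Sum>v\<in>verts G. card {h \<in> halves G. vert G h = v})"
    by (rule card_UN_disjoint) (use finite_verts finite_halves in auto)
  finally show ?thesis by (simp add: four_valent)
qed

text \<open>With \<open>n\<close> vertices, the \<open>2 * n\<close> half-edges of the path and
  their mates are disjoint and so exhaust all \<open>4 * n\<close>; the path runs through every edge
  exactly once.\<close>

lemma halves_eq: "halves G = set hs \<union> mate G ` set hs"
proof -
  have sub: "set hs \<union> mate G ` set hs \<subseteq> halves G"
    using path mate_in by (auto simp: traversing_path_def)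
  have "inj_on (mate G) (set hs)"
    by (rule inj_on_inverseI[of _ "mate G"]) (use sub mate_mate in auto)
  then have "card (mate G ` set hs) = card (set hs)" by (rule card_image)
  moreover have "card (set hs) = 2 * card (verts G)"
    using path by (auto simp: traversing_path_def distinct_card)
  moreover have "set hs \<inter> mate G ` set hs = {}" using mate_not_in_path by auto
  ultimately have "card (set hs \<union> mate G ` set hs) = card (halves G)"
    by (simp add: card_Un_disjoint card_halves)
  then show ?thesis using card_subset_eq[OF finite_halves sub] by simp
qed

lemma opp_in_path_iff:
  assumes "h \<in> halves G"
  shows "opp G h \<in> set hs \<longleftrightarrow> h \<notin> set hs"
proof (cases "h \<in> set hs")
  case True
  then obtain k where "h = path_at (k + length hs)"
    using set_path path_at_periodic by metis
  \<comment> \<open>The added period provides a predecessor even for the first half-edge.\<close>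
  then have "h = path_at (Suc (k + length hs - 1))" using length_pos by simp
  then have "opp G h = mate G (path_at (k + length hs - 1))"
    using path_at_Suc opp_opp mate_in path_at_in by metis
  then show ?thesis using mate_not_in_path path_at_in True by metis
next
  case False
  then obtain k where "h = mate G (path_at k)" using assms halves_eq set_path by blast
  then have "opp G h = path_at (Suc k)" by (simp add: path_at_Suc)
  then show ?thesis using False path_at_in by simp
qed

text \<open>In each of the two opposite pairs at \<open>v\<close> exactly one half-edge is used for
  leaving, so the path leaves \<open>v\<close> twice.\<close>

lemma count_vert:
  assumes "v \<in> verts G"
  shows "count_list (map (vert G) hs) v = 2"
proof -
  let ?F = "{h \<in> halves G. vert G h = v}" and ?P = "{h \<in> set hs. vert G h = v}"
  have hs: "set hs \<subseteq> halves G" "distinct hs" using path by (auto simp: traversing_path_def)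
  have F: "?F = ?P \<union> opp G ` ?P"
  proof (intro equalityI subsetI)
    fix h assume h: "h \<in> ?F"
    show "h \<in> ?P \<union> opp G ` ?P"
    proof (cases "h \<in> set hs")
      case False
      then have "opp G h \<in> ?P" using h opp_in_path_iff vert_opp by auto
      moreover have "h = opp G (opp G h)" using h opp_opp by auto
      ultimately show ?thesis by blast
    qed (use h in auto)
  qed (use hs opp_in vert_opp in auto)
  have "inj_on (opp G) ?P"
    by (rule inj_on_inverseI[of _ "opp G"]) (use hs opp_opp in auto)
  then have "card (opp G ` ?P) = card ?P" by (rule card_image)
  moreover have "?P \<inter> opp G ` ?P = {}" using hs opp_in_path_iff by auto
  ultimately have "card ?F = 2 * card ?P"
    unfolding F by (subst card_Un_disjoint) auto
  then show ?thesis
    using four_valent[OF assms] count_list_map_distinct[OF hs(2), of "vert G" v] by simp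
qed

text \<open>A traversing path is determined by its first half-edge, which lies on the given path or
  is the mate of one on it. The first case gives a rotation, the second a reversal.\<close>

lemma other_path:
  assumes "traversing_path G hs'"
  shows "\<exists>m. map (vert G) hs' = rotate m (map (vert G) hs) \<or>
    map (vert G) hs' = rev (rotate m (map (vert G) hs))"
proof -
  let ?n = "length hs"
  interpret t': traversed_graph G hs' by unfold_locales (use assms nonempty in auto)
  have len: "length hs' = ?n" using path assms by (simp add: traversing_path_def)
  have at': "hs' ! k = t'.path_at k" if "k < ?n" for k using that len by (simp add: t'.path_at_def)
  have "t'.path_at 0 \<in> halves G" by (rule t'.path_at_in)
  then consider i where "t'.path_at 0 = path_at i" | i where "t'.path_at 0 = mate G (path_at i)"
    using halves_eq set_path by blast
  then show ?thesis
  proof cases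
    case 1
    have "t'.path_at k = path_at (i + k)" for k
      by (induction k) (simp_all add: 1 path_at_Suc t'.path_at_Suc)
    then have "hs' ! k = rotate i hs ! k" if "k < ?n" for k
      using that by (simp add: at' nth_rotate path_at_def)
    then have "hs' = rotate i hs" by (intro nth_equalityI) (simp_all add: len)
    then show ?thesis by (auto simp: rotate_map)
  next
    case 2
    define j where "j = i + ?n"
    \<comment> \<open>The reversed path visits at step \<open>k\<close> the vertex of
      \<open>path_at (Suc (j - k))\<close>, while reversal of a list reads index
      \<open>n - 1 - k\<close> for length \<open>n\<close>. The two shifts by one make up the
      2.\<close>
    define m where "m = i + 2"
    have j: "t'.path_at 0 = mate G (path_at j)" using 2 by (simp add: j_def path_at_periodic)
    have reversed: "t'.path_at k = mate G (path_at (j - k))" if "k \<le> j" for k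
      using that
    proof (induction k)
      case (Suc k)
      then have "t'.path_at (Suc k) = opp G (mate G (mate G (path_at (j - k))))"
        by (simp add: t'.path_at_Suc)
      also have "\<dots> = opp G (path_at (Suc (j - Suc k)))"
        using Suc.prems mate_mate path_at_in by (simp add: Suc_diff_Suc)
      also have "\<dots> = mate G (path_at (j - Suc k))"
        using path_at_Suc opp_opp mate_in path_at_in by metis
      finally show ?case .
    qed (simp add: j)
    have v: "vert G (mate G (path_at k)) = vert G (path_at (Suc k))" for k
      unfolding path_at_Suc using vert_opp mate_in path_at_in by metis
    have "map (vert G) hs' ! k = rev (rotate m (map (vert G) hs)) ! k" if k: "k < ?n" for k
    proof -
      have "map (vert G) hs' ! k = vert G (path_at (Suc (j - k)))"
        using k reversed[of k] by (simp add: at' len v j_def)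
      moreover have "rev (rotate m (map (vert G) hs)) ! k =
          vert G (hs ! ((m + (?n - Suc k)) mod ?n))"
        using k length_pos by (simp add: rev_nth nth_rotate)
      moreover have "m + (?n - Suc k) = Suc (j - k)" using k by (simp add: j_def m_def)
      ultimately show ?thesis by (simp add: path_at_def)
    qed
    then have "map (vert G) hs' = rev (rotate m (map (vert G) hs))"
      by (intro nth_equalityI) (simp_all add: len)
    then show ?thesis by blast
  qed
qed

end

section \<open>Incidence read off from a single word\<close>

context framed_4_graph
begin

lemma chord_diagram_count:
  assumes "w \<in> chord_diagram G"
  shows "count_list w v = (if v \<in> verts G then 2 else 0)"
proof -
  obtain hs where hs: "traversing_path G hs" "w = map (vert G) hs"
    using assms by (auto simp: chord_diagram_def)
  show ?thesis
  proof (cases "v \<in> verts G")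
    case True
    then interpret traversed_graph G hs by unfold_locales (use hs in auto)
    show ?thesis using count_vert[OF True] True hs by simp
  next
    case False
    then have "v \<notin> set w" using hs vert_in by (auto simp: traversing_path_def)
    then show ?thesis using False by simp
  qed
qed

lemma set_chord_diagram:
  assumes "w \<in> chord_diagram G"
  shows "set w = verts G"
  using chord_diagram_count[OF assms]
  by (metis (mono_tags) count_list_0_iff subsetI subset_antisym zero_neq_numeral)

text \<open>Any two words of the diagram differ by rotation and reversal, both of which preserve
  linking.\<close>

lemma incident_iff_linked:
  assumes w: "w \<in> chord_diagram G" and "u \<in> verts G" "v \<in> verts G" "u \<noteq> v"
  shows "incident G u v \<longleftrightarrow> linked w u v"
proof -
  have "linked w' u v = linked w u v" if w': "w' \<in> chord_diagram G" for w'
  proof -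
    obtain hs where hs: "traversing_path G hs" "w = map (vert G) hs"
      using w by (auto simp: chord_diagram_def)
    obtain hs' where hs': "traversing_path G hs'" "w' = map (vert G) hs'"
      using w' by (auto simp: chord_diagram_def)
    interpret traversed_graph G hs by unfold_locales (use hs assms in auto)
    have c: "count_list w u = 2" "count_list w v = 2"
      using chord_diagram_count[OF w] assms by simp_all
    obtain m where "w' = rotate m w \<or> w' = rev (rotate m w)"
      using other_path[OF hs'(1)] hs hs' by auto
    then show ?thesis
      using linked_rotate[OF c \<open>u \<noteq> v\<close>] linked_rev[of "rotate m w" u v] c \<open>u \<noteq> v\<close> by auto
  qed
  then show ?thesis using assms unfolding incident_def by blast
qed

end

lemma incident_sym: "incident G u v = incident G v u"
  unfolding incident_def using linked_sym by metis

section \<open>Incidence under framed isomorphisms\<close>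

lemma linked_map: "linked w a b \<Longrightarrow> linked (map f w) (f a) (f b)"
proof -
  assume "linked w a b"
  then obtain i j k l where "i < j" "j < length w" "k < length w" "l < length w"
    "w ! i = a" "w ! j = a" "w ! k = b" "w ! l = b" "k \<in> {i<..<j}" "l \<notin> {i..j}"
    unfolding linked_def by blast
  then show ?thesis
    unfolding linked_def
    by (intro exI[of _ i] exI[of _ j] exI[of _ k] exI[of _ l]) simp
qed

lemma traversing_path_map:
  assumes "traversing_path G hs" and g: "bij_betw g (halves G) (halves G')"
    and "card (verts G) = card (verts G')"
    and G: "\<And>h. h \<in> halves G \<Longrightarrow> mate G h \<in> halves G"
    and eq: "\<And>h. h \<in> halves G \<Longrightarrow> mate G' (g h) = g (mate G h) \<and> opp G' (g h) = g (opp G h)"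
  shows "traversing_path G' (map g hs)"
  unfolding traversing_path_def
proof (intro conjI allI impI)
  have hs: "set hs \<subseteq> halves G" "distinct hs" "length hs = 2 * card (verts G)"
    and step: "i < length hs \<Longrightarrow> hs ! (Suc i mod length hs) = opp G (mate G (hs ! i))" for i
    using assms(1) by (auto simp: traversing_path_def)
  show "set (map g hs) \<subseteq> halves G'" using hs(1) bij_betwE[OF g] by auto
  show "distinct (map g hs)"
    using hs g by (auto simp: distinct_map bij_betw_def intro: inj_on_subset)
  show "length (map g hs) = 2 * card (verts G')" using hs assms by simp
  fix i assume i: "i < length (map g hs)"
  then have "hs ! i \<in> halves G" using hs(1) by auto
  moreover have "Suc i mod length hs < length hs" using i by (cases hs) auto
  ultimately show "map g hs ! (Suc i mod length (map g hs)) = opp G' (mate G' (map g hs ! i))"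
    using i step[of i] G eq by simp
qed

lemma incident_iso_imp:
  assumes f: "bij_betw f (verts G) (verts G')" and g: "bij_betw g (halves G) (halves G')"
    and G: "framed_4_graph G"
    and eq: "\<And>h. h \<in> halves G \<Longrightarrow> vert G' (g h) = f (vert G h) \<and> mate G' (g h) = g (mate G h) \<and>
           opp G' (g h) = g (opp G h)"
    and uv: "u \<in> verts G" "v \<in> verts G" "incident G u v"
  shows "incident G' (f u) (f v)"
proof -
  from uv(3) obtain hs where hs: "traversing_path G hs" "linked (map (vert G) hs) u v" "u \<noteq> v"
    unfolding incident_def chord_diagram_def by blast
  have "traversing_path G' (map g hs)"
    by (rule traversing_path_map[OF hs(1) g bij_betw_same_card[OF f]])
      (use eq framed_4_graph.mate_in[OF G] in auto)
  moreover have "map (vert G') (map g hs) = map f (map (vert G) hs)"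
    using eq hs(1) by (auto simp: traversing_path_def)
  moreover have "linked (map f (map (vert G) hs)) (f u) (f v)" by (rule linked_map[OF hs(2)])
  moreover have "f u \<noteq> f v" using uv hs(3) f by (auto simp: bij_betw_def inj_on_def)
  ultimately show ?thesis
    unfolding incident_def chord_diagram_def by (metis (mono_tags, lifting) mem_Collect_eq)
qed

lemma incident_iso:
  assumes f: "bij_betw f (verts G) (verts G')" and g: "bij_betw g (halves G) (halves G')"
    and G: "framed_4_graph G" and G': "framed_4_graph G'"
    and eq: "\<And>h. h \<in> halves G \<Longrightarrow> vert G' (g h) = f (vert G h) \<and> mate G' (g h) = g (mate G h) \<and>
           opp G' (g h) = g (opp G h)"
    and uv: "u \<in> verts G" "v \<in> verts G"
  shows "incident G' (f u) (f v) = incident G u v"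
proof
  let ?f = "inv_into (verts G) f" and ?g = "inv_into (halves G) g"
  have f': "?f (f x) = x" if "x \<in> verts G" for x
    by (rule bij_betw_inv_into_left[OF f that])
  have g': "?g (g x) = x" if "x \<in> halves G" for x
    by (rule bij_betw_inv_into_left[OF g that])
  assume inc: "incident G' (f u) (f v)"
  have eq': "vert G (?g k) = ?f (vert G' k) \<and> mate G (?g k) = ?g (mate G' k) \<and>
      opp G (?g k) = ?g (opp G' k)" if k: "k \<in> halves G'" for k
  proof -
    obtain h where h: "h \<in> halves G" "k = g h" using k bij_betw_imp_surj_on[OF g] by blast
    then show ?thesis
      using eq[OF h(1)] f' g' framed_4_graph.vert_in[OF G] framed_4_graph.mate_in[OF G]
        framed_4_graph.opp_in[OF G] by simp
  qed
  have fuv: "f u \<in> verts G'" "f v \<in> verts G'"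
    using uv by (simp_all flip: bij_betw_imp_surj_on[OF f])
  have "incident G (?f (f u)) (?f (f v))"
    using incident_iso_imp[OF bij_betw_inv_into[OF f] bij_betw_inv_into[OF g] G' eq' fuv inc] .
  then show "incident G u v" by (simp only: f'[OF uv(1)] f'[OF uv(2)])
qed (rule incident_iso_imp[OF f g G eq uv])

section \<open>Invariance of the bracket under isomorphisms and the three moves\<close>

context pattern
begin

lemma bracket_framed_iso:
  assumes "framed_iso G G'" and G: "framed_4_graph G" and G': "framed_4_graph G'"
  shows "bracket (incident G) (verts G) = bracket (incident G') (verts G')"
proof -
  obtain f g where f: "bij_betw f (verts G) (verts G')" and g: "bij_betw g (halves G) (halves G')"
    and eq: "\<And>h. h \<in> halves G \<Longrightarrow> vert G' (g h) = f (vert G h) \<and> mate G' (g h) = g (mate G h) \<and>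
           opp G' (g h) = g (opp G h)"
    using assms(1) unfolding framed_iso_def by blast
  have "verts G' = f ` verts G" and inj: "inj_on f (verts G)" using f by (auto simp: bij_betw_def)
  then have "bracket (incident G') (verts G') =
      bracket (\<lambda>p q. incident G' (f p) (f q)) (verts G)"
    by (simp add: bracket_relabel)
  also have "\<dots> = bracket (incident G) (verts G)"
    by (rule bracket_cong) (rule incident_iso[OF f g G G' eq])
  finally show ?thesis by simp
qed

text \<open>Nothing lies between the two ends of the new chord, so it is linked with no other, and
  deleting it leaves all other two-letter subwords alone.\<close>

lemma bracket_first:
  assumes G: "framed_4_graph G" and G': "framed_4_graph G'"
    and w: "x @ y \<in> chord_diagram G" and w': "x @ [a, a] @ y \<in> chord_diagram G'"
  shows "bracket (incident G) (verts G) = bracket (incident G') (verts G')"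
proof -
  note c = framed_4_graph.chord_diagram_count[OF G w]
    and c' = framed_4_graph.chord_diagram_count[OF G' w']
  have V: "set (x @ y) = verts G" "set (x @ [a, a] @ y) = verts G'"
    by (rule framed_4_graph.set_chord_diagram[OF G w] framed_4_graph.set_chord_diagram[OF G' w'])+
  then have a': "a \<in> verts G'" by auto
  then have "count_list (x @ y) a = 0" using c'[of a] by simp
  then have a: "a \<notin> set x" "a \<notin> set y" by (auto simp: count_list_0_iff)
  have V': "verts G' = insert a (verts G)" "a \<notin> verts G" using V a by auto
  have isolated: "\<not> incident G' a v" if v: "v \<in> verts G" for v
  proof -
    have v': "v \<in> verts G'" "a \<noteq> v" using v V' by auto
    have "linked (x @ [a, a] @ y) a v \<longleftrightarrow> count_list [] v = 1"
      by (rule linked_iff_between[of _ x a "[]" y]) (use a c'[of v] v' in auto)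
    then show ?thesis
      using framed_4_graph.incident_iff_linked[OF G' w' a' v'] by simp
  qed
  have same: "incident G u v = incident G' u v" if uv: "u \<in> verts G" "v \<in> verts G" "u \<noteq> v" for u v
  proof -
    have uv': "u \<in> verts G'" "v \<in> verts G'" "a \<noteq> u" "a \<noteq> v" using uv V' by auto
    have "filter (\<lambda>x. x = u \<or> x = v) (x @ y) = filter (\<lambda>x. x = u \<or> x = v) (x @ [a, a] @ y)"
      using uv' by simp
    then have "linked (x @ y) u v = linked (x @ [a, a] @ y) u v"
      by (rule linked_cong_filter[rotated 5]) (simp_all only: c c' uv uv' if_True not_False_eq_True)
    then show ?thesis
      using framed_4_graph.incident_iff_linked[OF G' w' uv'(1,2) uv(3)]
        framed_4_graph.incident_iff_linked[OF G w uv] by simp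
  qed
  have "bracket (incident G) (verts G) = bracket (incident G') (verts G)"
    by (rule bracket_cong[OF same])
  also have "\<dots> = bracket (incident G') (verts G')"
    unfolding V'(1)
  proof (rule bracket_isolated[OF framed_4_graph.finite_verts[OF G] V'(2), symmetric])
    show "\<not> incident G' a v \<and> \<not> incident G' v a" if "v \<in> verts G" for v
      using isolated[OF that] incident_sym[of G' a v] by simp
  qed
  finally show ?thesis .
qed

text \<open>The stretches between the ends of \<open>a\<close> and between those of \<open>b\<close>
  both consist of \<open>y\<close> and possibly letters \<open>a\<close> and \<open>b\<close>, so
  the two chords are linked with the same other chords.\<close>

lemma bracket_second:
  assumes G: "framed_4_graph G" and G': "framed_4_graph G'"
    and ab: "a \<noteq> b" and q: "q \<in> {[a, b], [b, a]}"
    and w: "x @ y @ z \<in> chord_diagram G" and w': "x @ [a, b] @ y @ q @ z \<in> chord_diagram G'"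
  shows "bracket (incident G) (verts G) = bracket (incident G') (verts G')"
proof -
  let ?w' = "x @ [a, b] @ y @ q @ z"
  note c = framed_4_graph.chord_diagram_count[OF G w]
    and c' = framed_4_graph.chord_diagram_count[OF G' w']
  have V: "set (x @ y @ z) = verts G" "set ?w' = verts G'"
    by (rule framed_4_graph.set_chord_diagram[OF G w] framed_4_graph.set_chord_diagram[OF G' w'])+
  have ab': "a \<in> verts G'" "b \<in> verts G'" using V by auto
  have q2: "count_list q a = 1" "count_list q b = 1" using q ab by auto
  have "count_list (x @ y @ z) a = 0" "count_list (x @ y @ z) b = 0"
    using c'[of a] c'[of b] ab ab' q2 by simp_all
  then have a: "a \<notin> set x" "a \<notin> set y" "a \<notin> set z" and b: "b \<notin> set x" "b \<notin> set y" "b \<notin> set z"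
    by (auto simp: count_list_0_iff)
  have V': "verts G' = insert a (insert b (verts G))" "a \<notin> verts G" "b \<notin> verts G"
    using V a b q by auto
  have twins: "incident G' b v = incident G' a v" if v: "v \<in> verts G" for v
  proof -
    have v': "v \<in> verts G'" "a \<noteq> v" "b \<noteq> v" using v V' by auto
    have cv: "count_list ?w' v = 2" using c'[of v] v' by simp
    obtain y1 z1 where 1: "?w' = x @ a # y1 @ a # z1" "a \<notin> set y1" "a \<notin> set z1"
        "count_list y1 v = count_list y v"
    proof (cases "q = [a, b]")
      case True
      then show ?thesis using a ab v' by (intro that[of "b # y" "b # z"]) auto
    next
      case False
      then show ?thesis using a ab v' q by (intro that[of "b # y @ [b]" z]) auto
    qed
    obtain y2 z2 where 2: "?w' = (x @ [a]) @ b # y2 @ b # z2" "b \<notin> set y2" "b \<notin> set z2"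
        "count_list y2 v = count_list y v"
    proof (cases "q = [a, b]")
      case True
      then show ?thesis using b ab v' by (intro that[of "y @ [a]" "z"]) auto
    next
      case False
      then show ?thesis using b ab v' q by (intro that[of "y" "a # z"]) auto
    qed
    have "linked ?w' a v \<longleftrightarrow> count_list y v = 1"
      unfolding 1(4)[symmetric]
      by (rule linked_iff_between[OF 1(1) a(1) 1(2,3) cv v'(2)[symmetric]])
    moreover have "linked ?w' b v \<longleftrightarrow> count_list y v = 1"
      unfolding 2(4)[symmetric]
      by (rule linked_iff_between[OF 2(1) _ 2(2,3) cv v'(3)[symmetric]]) (use b ab in simp)
    ultimately show ?thesis
      using framed_4_graph.incident_iff_linked[OF G' w' ab'(1) v'(1,2)]
        framed_4_graph.incident_iff_linked[OF G' w' ab'(2) v'(1,3)] by simp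
  qed
  have same: "incident G u v = incident G' u v" if uv: "u \<in> verts G" "v \<in> verts G" "u \<noteq> v" for u v
  proof -
    have uv': "u \<in> verts G'" "v \<in> verts G'" "a \<noteq> u" "a \<noteq> v" "b \<noteq> u" "b \<noteq> v" using uv V' by auto
    have "filter (\<lambda>x. x = u \<or> x = v) q = []" using q uv' by auto
    then have "filter (\<lambda>x. x = u \<or> x = v) (x @ y @ z) = filter (\<lambda>x. x = u \<or> x = v) ?w'"
      using uv' by simp
    then have "linked (x @ y @ z) u v = linked ?w' u v"
      by (rule linked_cong_filter[rotated 5]) (simp_all only: c c' uv uv' if_True not_False_eq_True)
    then show ?thesis
      using framed_4_graph.incident_iff_linked[OF G' w' uv'(1,2) uv(3)]
        framed_4_graph.incident_iff_linked[OF G w uv] by simp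
  qed
  have "bracket (incident G) (verts G) = bracket (incident G') (verts G)"
    by (rule bracket_cong[OF same])
  also have "\<dots> = bracket (incident G') (verts G')"
    unfolding V'(1)
    by (rule bracket_twins[OF framed_4_graph.finite_verts[OF G] V'(2,3) ab incident_sym twins,
          symmetric])
  finally show ?thesis .
qed

text \<open>Apart from the triangle letters, the interval of \<open>b\<close> is \<open>y\<close>,
  that of \<open>c\<close> is \<open>z\<close>, and that of \<open>a\<close> is \<open>y\<close>
  together with \<open>z\<close>; hence the row relation. Reversing a pair moves one end of either
  chord across one end of the other and so toggles their linking.\<close>

lemma bracket_third:
  assumes G: "framed_4_graph G" and G': "framed_4_graph G'"
    and abc: "distinct [a, b, c]"
    and p: "p \<in> {[a, b], [b, a]}" and q: "q \<in> {[b, c], [c, b]}" and r: "r \<in> {[a, c], [c, a]}"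
    and w: "x @ p @ y @ q @ z @ r @ t \<in> chord_diagram G"
    and w': "x @ rev p @ y @ rev q @ z @ rev r @ t \<in> chord_diagram G'"
  shows "bracket (incident G) (verts G) = bracket (incident G') (verts G')"
proof -
  let ?w = "x @ p @ y @ q @ z @ r @ t" and ?w' = "x @ rev p @ y @ rev q @ z @ rev r @ t"
  note cw = framed_4_graph.chord_diagram_count[OF G w]
    and cw' = framed_4_graph.chord_diagram_count[OF G' w']
  have ne: "a \<noteq> b" "a \<noteq> c" "b \<noteq> c" using abc by auto
  have V: "set ?w = verts G" "set ?w' = verts G'"
    by (rule framed_4_graph.set_chord_diagram[OF G w] framed_4_graph.set_chord_diagram[OF G' w'])+
  then have VV: "verts G' = verts G" by auto
  have pair: "set s = {i, j}" "count_list s i = 1" "count_list s j = 1"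
    "k \<noteq> i \<Longrightarrow> k \<noteq> j \<Longrightarrow> count_list s k = 0"
    if "s \<in> {[i, j], [j, i]}" "i \<noteq> j" for s and i j k :: 'a
    using that by auto
  note pp = pair[OF p ne(1)] and qq = pair[OF q ne(3)] and rr = pair[OF r ne(2)]
  have mem: "a \<in> verts G" "b \<in> verts G" "c \<in> verts G"
    by (simp_all add: V(1)[symmetric] pp(1) qq(1))
  have "count_list p a = 1" "count_list p b = 1" "count_list q b = 1" "count_list q c = 1"
    "count_list r a = 1" "count_list r c = 1" by (fact pp qq rr)+
  then have "a \<notin> set x \<union> set y \<union> set z \<union> set t" "b \<notin> set x \<union> set y \<union> set z \<union> set t"
    "c \<notin> set x \<union> set y \<union> set z \<union> set t"
    using cw[of a] cw[of b] cw[of c] mem by (simp_all add: count_list_0_iff)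
  then have fresh: "a \<notin> set x" "a \<notin> set y" "a \<notin> set z" "a \<notin> set t"
    "b \<notin> set x" "b \<notin> set y" "b \<notin> set z" "b \<notin> set t"
    "c \<notin> set x" "c \<notin> set y" "c \<notin> set z" "c \<notin> set t" by auto
  note fresh0 = fresh[THEN count_notin]
  \<comment> \<open>Stated for arbitrary orders within the three pairs, so that it applies to the
    words before and after the move alike.\<close>
  have main: "linked u a b = (p1 = [b, a])" "linked u a c = (r1 = [a, c])"
    "linked u b c = (q1 = [c, b])"
    "\<And>v. count_list u v = 2 \<Longrightarrow> v \<notin> {a, b, c} \<Longrightarrow> linked u c v = (linked u a v \<noteq> linked u b v)"
    if u: "u = x @ p1 @ y @ q1 @ z @ r1 @ t" and p1: "p1 \<in> {[a, b], [b, a]}"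
      and q1: "q1 \<in> {[b, c], [c, b]}" and r1: "r1 \<in> {[a, c], [c, a]}"
    for u p1 q1 r1
  proof -
    note pp1 = pair[OF p1 ne(1)] and qq1 = pair[OF q1 ne(3)] and rr1 = pair[OF r1 ne(2)]
    have s1: "count_list p1 a = 1" "count_list p1 b = 1" "count_list p1 c = 0"
      "count_list q1 a = 0" "count_list q1 b = 1" "count_list q1 c = 1"
      "count_list r1 a = 1" "count_list r1 b = 0" "count_list r1 c = 1"
      using ne by (simp_all add: pp1 qq1 rr1)
    have cu: "count_list u a = 2" "count_list u b = 2" "count_list u c = 2"
      unfolding u by (simp_all add: s1 fresh0)
    \<comment> \<open>Each pair is cut at one of its letters. The pieces, of length at most one,
      record whether the partner falls inside or outside the interval of that letter.\<close>
    define pa pb qb qc ra rc where "pa = (if p1 = [a, b] then [] else [b])"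
      and "pb = (if p1 = [a, b] then [] else [a])" and "qb = (if q1 = [b, c] then [] else [c])"
      and "qc = (if q1 = [b, c] then [] else [b])" and "ra = (if r1 = [a, c] then [] else [c])"
      and "rc = (if r1 = [a, c] then [] else [a])"
    define pa' pb' qb' qc' ra' rc' where "pa' = (if p1 = [a, b] then [b] else [])"
      and "pb' = (if p1 = [a, b] then [a] else [])" and "qb' = (if q1 = [b, c] then [c] else [])"
      and "qc' = (if q1 = [b, c] then [b] else [])" and "ra' = (if r1 = [a, c] then [c] else [])"
      and "rc' = (if r1 = [a, c] then [a] else [])"
    note defs = pa_def pb_def qb_def qc_def ra_def rc_def
      pa'_def pb'_def qb'_def qc'_def ra'_def rc'_def
    have ps: "p1 = pa @ a # pa'" "q1 = qb @ b # qb'" "p1 = pb' @ b # pb" "q1 = qc' @ c # qc"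
      "r1 = ra @ a # ra'" "r1 = rc' @ c # rc"
      using p1 q1 r1 by (simp_all add: defs, blast+)
    have out: "a \<notin> set pa" "a \<notin> set pa'" "a \<notin> set ra" "a \<notin> set ra'" "b \<notin> set pb" "b \<notin> set pb'"
      "b \<notin> set qb" "b \<notin> set qb'" "c \<notin> set qc" "c \<notin> set qc'" "c \<notin> set rc" "c \<notin> set rc'"
      "a \<notin> set q1" "b \<notin> set r1" "c \<notin> set p1"
      using ne by (simp_all add: defs pp1(1) qq1(1) rr1(1))
    have ea: "u = (x @ pa) @ a # (pa' @ y @ q1 @ z @ ra) @ a # (ra' @ t)"
      unfolding u by (subst ps(1), subst ps(5)) (simp only: append_assoc append_Cons append_Nil)
    have eb: "u = (x @ pb') @ b # (pb @ y @ qb) @ b # (qb' @ z @ r1 @ t)"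
      unfolding u by (subst ps(3), subst ps(2)) (simp only: append_assoc append_Cons append_Nil)
    have ec: "u = (x @ p1 @ y @ qc') @ c # (qc @ z @ rc') @ c # (rc @ t)"
      unfolding u by (subst ps(4), subst ps(6)) (simp only: append_assoc append_Cons append_Nil)
    have la: "linked u a v \<longleftrightarrow> count_list (pa' @ y @ q1 @ z @ ra) v = 1"
      if "count_list u v = 2" "v \<noteq> a" for v
      by (rule linked_iff_between[OF ea _ _ _ that]) (simp_all add: out fresh)
    have lb: "linked u b v \<longleftrightarrow> count_list (pb @ y @ qb) v = 1"
      if "count_list u v = 2" "v \<noteq> b" for v
      by (rule linked_iff_between[OF eb _ _ _ that]) (simp_all add: out fresh)
    have lc: "linked u c v \<longleftrightarrow> count_list (qc @ z @ rc') v = 1"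
      if "count_list u v = 2" "v \<noteq> c" for v
      by (rule linked_iff_between[OF ec _ _ _ that]) (simp_all add: out fresh)
    show "linked u a b = (p1 = [b, a])"
      unfolding la[OF cu(2) ne(1)[symmetric]] using p1 ne
      by (auto simp: pa'_def ra_def s1 fresh0)
    show "linked u a c = (r1 = [a, c])"
      unfolding la[OF cu(3) ne(2)[symmetric]] using r1 ne
      by (auto simp: pa'_def ra_def s1 fresh0)
    show "linked u b c = (q1 = [c, b])"
      unfolding lb[OF cu(3) ne(3)[symmetric]] using q1 ne
      by (auto simp: pb_def qb_def s1 fresh0)
    show "linked u c v = (linked u a v \<noteq> linked u b v)"
      if v: "count_list u v = 2" "v \<notin> {a, b, c}" for v
    proof -
      have v0: "count_list p1 v = 0" "count_list q1 v = 0" "count_list r1 v = 0"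
        "count_list pa' v = 0" "count_list ra v = 0" "count_list pb v = 0" "count_list qb v = 0"
        "count_list qc v = 0" "count_list rc' v = 0"
        using v(2) by (simp_all add: defs pp1 qq1 rr1)
      have "count_list x v + count_list y v + count_list z v + count_list t v = 2"
        using v(1) v0 by (simp add: u)
      moreover have "v \<noteq> a" "v \<noteq> b" "v \<noteq> c" using v by auto
      ultimately show ?thesis
        using la[OF v(1)] lb[OF v(1)] lc[OF v(1)] v0 by (simp, linarith)
    qed
  qed
  have rv: "rev s \<in> {[i, j], [j, i]}" "(rev s = [i, j]) = (s \<noteq> [i, j])" "(rev s = [j, i]) = (s \<noteq> [j, i])"
    if "s \<in> {[i, j], [j, i]}" "i \<noteq> j" for s and i j :: 'a
    using that by auto
  note p' = rv(1)[OF p ne(1)] and q' = rv(1)[OF q ne(3)] and r' = rv(1)[OF r ne(2)]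
  note m = main[OF refl p q r] and m' = main[OF refl p' q' r']
  note inc = framed_4_graph.incident_iff_linked[OF G w]
  note inc' = framed_4_graph.incident_iff_linked[OF G' w', unfolded VV]
  have same: "incident G' u v = incident G u v"
    if uv: "u \<in> verts G" "v \<in> verts G" and v: "v \<notin> {a, b, c}" for u v
  proof (cases "u = v")
    case True
    then show ?thesis by (simp add: incident_def)
  next
    case ne_uv: False
    have uv': "u \<in> verts G'" "v \<in> verts G'" using uv VV by simp_all
    have v0: "filter (\<lambda>x. x = u \<or> x = v) (rev s) = filter (\<lambda>x. x = u \<or> x = v) s"
      if "s \<in> {[i, j], [j, i]}" "i \<noteq> j" "v \<noteq> i" "v \<noteq> j" for s i j
      using that by auto
    have "filter (\<lambda>x. x = u \<or> x = v) ?w' = filter (\<lambda>x. x = u \<or> x = v) ?w"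
      using v0[OF p ne(1)] v0[OF q ne(3)] v0[OF r ne(2)] v by simp
    then have "linked ?w' u v = linked ?w u v"
      by (rule linked_cong_filter[rotated 5])
        (simp_all only: cw cw' uv uv' ne_uv if_True not_False_eq_True)
    then show ?thesis using inc[OF uv ne_uv] inc'[OF uv ne_uv] by simp
  qed
  have "triangle_move (incident G) (incident G') (verts G) a b c"
  proof (rule triangle_move.intro[OF ne mem incident_sym incident_sym _ same])
    show "incident G c v = (incident G a v \<noteq> incident G b v)"
      if v: "v \<in> verts G" "v \<notin> {a, b, c}" for v
    proof -
      have "count_list ?w v = 2" using cw[of v] v by simp
      from m(4)[OF this v(2)] show ?thesis
        using inc[OF mem(1) v(1)] inc[OF mem(2) v(1)] inc[OF mem(3) v(1)] v(2) by auto
    qed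
    show "incident G' a b = (\<not> incident G a b)"
      using m(1) m'(1) inc[OF mem(1,2) ne(1)] inc'[OF mem(1,2) ne(1)] rv[OF p ne(1)] by simp
    show "incident G' a c = (\<not> incident G a c)"
      using m(2) m'(2) inc[OF mem(1,3) ne(2)] inc'[OF mem(1,3) ne(2)] rv[OF r ne(2)] by simp
    show "incident G' b c = (\<not> incident G b c)"
      using m(3) m'(3) inc[OF mem(2,3) ne(3)] inc'[OF mem(2,3) ne(3)] rv[OF q ne(3)] by simp
  qed
  then show ?thesis
    unfolding VV by (rule bracket_triangle) (rule framed_4_graph.finite_verts[OF G])
qed

lemma bracket_reidemeister:
  assumes "reidemeister_move G G'"
  shows "bracket (incident G) (verts G) = bracket (incident G') (verts G')"
proof -
  obtain w w' where w: "w \<in> chord_diagram G" "w' \<in> chord_diagram G'" "reidemeister_word w w'"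
    and G: "framed_4_graph G" and G': "framed_4_graph G'"
    using assms unfolding reidemeister_move_def knot_graph_def by blast
  from w(3,1,2) show ?thesis
  proof cases
    case first
    then show ?thesis using w bracket_first[OF G G'] by blast
  next
    case second
    then show ?thesis using w bracket_second[OF G G'] by blast
  next
    case third
    then show ?thesis using w bracket_third[OF G G'] by blast
  qed
qed

lemma bracket_same_free_knot:
  assumes "same_free_knot G G'"
  shows "bracket (incident G) (verts G) = bracket (incident G') (verts G')"
  using assms unfolding same_free_knot_def
proof (induction rule: equivclp_induct)
  case (step G' G'')
  let ?R = "\<lambda>G G'. knot_graph G \<and> knot_graph G' \<and> (framed_iso G G' \<or> reidemeister_move G G')"
  have "bracket (incident H) (verts H) = bracket (incident H') (verts H')" if "?R H H'" for H H'
    using that bracket_framed_iso[of H H'] bracket_reidemeister[of H H']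
    by (auto simp: knot_graph_def)
  then show ?case using step by metis
qed simp

end

lemma smoothing_exists:
  assumes "finite (verts G)" "k \<le> card (verts G)"
    and "\<And>h. h \<in> halves G \<Longrightarrow> vert G (opp G h) = vert G h"
    and "\<And>v. v \<in> verts G \<Longrightarrow>
      \<exists>a \<in> halves G. \<exists>b \<in> halves G. vert G a = v \<and> vert G b = v \<and> b \<noteq> a \<and> b \<noteq> opp G a"
  shows "\<exists>Gs. is_smoothing G Gs \<and> card (verts Gs) = k"
  using assms
proof (induction "card (verts G) - k" arbitrary: G)
  case 0
  then have "card (verts G) = k" by simp
  then show ?case unfolding is_smoothing_def by blast
next
  case (Suc m)
  then have "verts G \<noteq> {}" by auto
  then obtain v where v: "v \<in> verts G" by blast
  then obtain a b where ab: "a \<in> halves G" "b \<in> halves G" "vert G a = v" "vert G b = v"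
      "b \<noteq> a" "b \<noteq> opp G a"
    using Suc.prems(4) by blast
  define H where "H = remove_vertex v (join (opp G a) (opp G b) (join a b G))"
  have sm: "smoothing_at v G H"
    unfolding smoothing_at_def H_def using v ab by blast
  have H: "verts H = verts G - {v}" "halves H = halves G - {a, b, opp G a, opp G b}"
    "vert H = vert G" "opp H = opp G"
    by (auto simp: H_def remove_vertex_def join_def Let_def)
  have removed: "vert G (opp G a) = v" "vert G (opp G b) = v" using Suc.prems(3) ab by auto
  have "\<exists>Gs. is_smoothing H Gs \<and> card (verts Gs) = k"
  proof (rule Suc.hyps(1))
    show "m = card (verts H) - k" "finite (verts H)" "k \<le> card (verts H)"
      using Suc.hyps(2) Suc.prems(1) v by (auto simp: H)
    show "vert H (opp H h) = vert H h" if "h \<in> halves H" for h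
      using that Suc.prems(3) by (simp add: H)
    show "\<exists>a \<in> halves H. \<exists>b \<in> halves H. vert H a = u \<and> vert H b = u \<and> b \<noteq> a \<and> b \<noteq> opp H a"
      if u: "u \<in> verts H" for u
    proof -
      have "u \<in> verts G" "u \<noteq> v" using u by (auto simp: H)
      then obtain c d where cd: "c \<in> halves G" "d \<in> halves G" "vert G c = u" "vert G d = u"
          "d \<noteq> c" "d \<noteq> opp G c"
        using Suc.prems(4) by blast
      then have "c \<in> halves H" "d \<in> halves H"
        using \<open>u \<noteq> v\<close> ab removed by (auto simp: H)
      then show ?thesis using cd by (auto simp: H)
    qed
  qed
  then obtain Gs where Gs: "is_smoothing H Gs" "card (verts Gs) = k" by blast
  let ?R = "\<lambda>G G'. \<exists>v. smoothing_at v G G'"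
  have "?R\<^sup>*\<^sup>* G Gs"
    by (rule converse_rtranclp_into_rtranclp[of ?R]) (use Gs(1) sm in \<open>auto simp: is_smoothing_def\<close>)
  then have "is_smoothing G Gs" by (simp add: is_smoothing_def)
  then show ?case using Gs(2) by blast
qed

lemma (in framed_4_graph) non_opposite_halves:
  assumes "v \<in> verts G"
  shows "\<exists>a \<in> halves G. \<exists>b \<in> halves G. vert G a = v \<and> vert G b = v \<and> b \<noteq> a \<and> b \<noteq> opp G a"
proof -
  let ?F = "{h \<in> halves G. vert G h = v}"
  have "?F \<noteq> {}" using four_valent[OF assms] by (metis card.empty zero_neq_numeral)
  then obtain a where a: "a \<in> ?F" by blast
  have "\<not> ?F \<subseteq> {a, opp G a}"
  proof
    assume "?F \<subseteq> {a, opp G a}"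
    then have "card ?F \<le> card {a, opp G a}" by (intro card_mono) auto
    also have "\<dots> \<le> 2" by (simp add: card_insert_if)
    finally show False using four_valent[OF assms] by simp
  qed
  then show ?thesis using a by blast
qed

theorem corollary1:
  fixes G :: "('v::infinite, 'h::infinite) framed_graph"
  assumes "knot_graph G" and "irreducibly_odd G"
  shows "(\<forall>G' \<in> free_knot G. \<exists>G\<^sub>s. is_smoothing G' G\<^sub>s \<and> card (verts G\<^sub>s) = card (verts G)) \<and>
    G \<in> free_knot G \<and> (\<forall>G' \<in> free_knot G. card (verts G) \<le> card (verts G'))"
proof -
  have G: "framed_4_graph G" using assms by (simp add: knot_graph_def)
  then have fin: "finite (verts G)" by (rule framed_4_graph.finite_verts)
  \<comment> \<open>The target is the incidence graph of \<open>G\<close> itself; absence of twins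
    is the second half of irreducible oddness.\<close>
  interpret pattern "verts G" "incident G"
    by unfold_locales (use fin assms(2) in \<open>auto simp: irreducibly_odd_def\<close>)
  have "{u \<in> verts G. u \<noteq> v \<and> incident G v u} = {u \<in> verts G. incident G v u}" for v
    by (auto simp: incident_def)
  then have "odd_set (incident G) (verts G) = verts G"
    using assms(2) fin
    by (auto simp: odd_set_def degree2_eq_1_iff irreducibly_odd_def odd_vertex_def even_vertex_def)
  then have 1: "bracket (incident G) (verts G) = 1" by (rule bracket_pattern)
  have le: "card (verts G) \<le> card (verts G')" if "G' \<in> free_knot G" for G'
  proof -
    have "same_free_knot G G'" "framed_4_graph G'"
      using that by (auto simp: free_knot_def knot_graph_def)
    then show ?thesis
      using bracket_same_free_knot 1 card_le_of_bracket framed_4_graph.finite_verts by metis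
  qed
  moreover have "\<exists>G\<^sub>s. is_smoothing G' G\<^sub>s \<and> card (verts G\<^sub>s) = card (verts G)"
    if "G' \<in> free_knot G" for G'
  proof -
    interpret G': framed_4_graph G' using that by (simp add: free_knot_def knot_graph_def)
    show ?thesis
      by (rule smoothing_exists[OF G'.finite_verts le[OF that] G'.vert_opp G'.non_opposite_halves])
  qed
  moreover have "G \<in> free_knot G"
    using assms(1) by (simp add: free_knot_def same_free_knot_def)
  ultimately show ?thesis by blast
qed

end
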